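(* There is a polynomial-time randomized algorithm that, given as input vectors $v_1,\dots,v_n\in\mathbb{R}^m$ with $\|v_i\|_2\le 1$ for all $i$, and a vector $x_0\in[-1,1]^n$, outputs a coloring $x\in\{-1,1\}^n$ such that the random vector $\sum_{i=1}^n (x(i)-x_0(i))v_i$ is subgaussian with parameter $\sigma=\sqrt{40}$.
   Context: A random vector $Y$ taking values in $\mathbb{R}^m$ is called subgaussian with parameter $\sigma$ (or $\sigma$-subgaussian) if for all $\theta\in\mathbb{R}^m$, $\mathbb{E}[e^{\langle\theta,Y\rangle}]\le e^{(\sigma^2/2)\|\theta\|_2^2}$. *)

theory Defs
  imports "HOL-Probability.Probability" "HOL-Computational_Algebra.Polynomial"
begin

text \<open>
  A vector of \<open>\<real>\<^sup>m\<close> is a function \<open>nat \<Rightarrow> real\<close> of which only the entries below \<open>m\<close> are used;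
  its Euclidean norm is \<open>L2_set _ {..<m}\<close>.
\<close>

definition subgaussian :: "nat \<Rightarrow> 'a measure \<Rightarrow> ('a \<Rightarrow> nat \<Rightarrow> real) \<Rightarrow> real \<Rightarrow> bool" where
  "subgaussian m M Y \<sigma> \<longleftrightarrow>
     prob_space M \<and>
     (\<forall>j<m. (\<lambda>\<omega>. Y \<omega> j) \<in> borel_measurable M) \<and>
     (\<forall>\<theta>::nat \<Rightarrow> real.
        integrable M (\<lambda>\<omega>. exp (\<Sum>j<m. \<theta> j * Y \<omega> j)) \<and>
        (\<integral>\<omega>. exp (\<Sum>j<m. \<theta> j * Y \<omega> j) \<partial>M) \<le> exp (\<sigma>\<^sup>2 / 2 * (L2_set \<theta> {..<m})\<^sup>2))"

text \<open>
  Algorithms on real inputs are programs of a randomized real RAM. A store has counters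
  (natural numbers) and two-dimensional real arrays, addressed indirectly through counters.
  Real arithmetic and comparisons are exact and have unit cost. Constants are integers, since
  an arbitrary real constant could encode an infinite amount of advice; there is no rounding of
  reals to integers, and counters cannot be multiplied. The only source of randomness is a coin
  whose bias is a computed real, that is, the test \<open>U < p\<close> for a fresh uniform \<open>U\<close> on \<open>[0,1]\<close>.
\<close>

record store =
  cnt :: "nat \<Rightarrow> nat"
  arr :: "nat \<Rightarrow> nat \<Rightarrow> nat \<Rightarrow> real"

datatype nexp =
    NConst nat
  | NVar nat
  | NPlus nexp nexp
  | NMinus nexp nexp

datatype rexp =
    RConst int
  | RGet nat nexp nexp
  | RPlus rexp rexp
  | RMinus rexp rexp
  | RTimes rexp rexp
  | RDiv rexp rexp

datatype bexp =
    NLess nexp nexp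
  | RLess rexp rexp
  | BNot bexp
  | BAnd bexp bexp

datatype com =
    Skip
  | NSet nat nexp
  | RSet nat nexp nexp rexp
  | Flip nat rexp
  | Seq com com
  | Cond bexp com com
  | While bexp com

primrec nval :: "nexp \<Rightarrow> store \<Rightarrow> nat" where
  "nval (NConst k) s = k"
| "nval (NVar x) s = cnt s x"
| "nval (NPlus a b) s = nval a s + nval b s"
| "nval (NMinus a b) s = nval a s - nval b s"

primrec rval :: "rexp \<Rightarrow> store \<Rightarrow> real" where
  "rval (RConst k) s = of_int k"
| "rval (RGet A i j) s = arr s A (nval i s) (nval j s)"
| "rval (RPlus a b) s = rval a s + rval b s"
| "rval (RMinus a b) s = rval a s - rval b s"
| "rval (RTimes a b) s = rval a s * rval b s"
| "rval (RDiv a b) s = rval a s / rval b s"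

primrec bval :: "bexp \<Rightarrow> store \<Rightarrow> bool" where
  "bval (NLess a b) s \<longleftrightarrow> nval a s < nval b s"
| "bval (RLess a b) s \<longleftrightarrow> rval a s < rval b s"
| "bval (BNot b) s \<longleftrightarrow> \<not> bval b s"
| "bval (BAnd b c) s \<longleftrightarrow> bval b s \<and> bval c s"

definition set_cnt :: "nat \<Rightarrow> nat \<Rightarrow> store \<Rightarrow> store" where
  "set_cnt x k s = s\<lparr>cnt := (cnt s)(x := k)\<rparr>"

definition set_arr :: "nat \<Rightarrow> nat \<Rightarrow> nat \<Rightarrow> real \<Rightarrow> store \<Rightarrow> store" where
  "set_arr A i j r s = s\<lparr>arr := (arr s)(A := (arr s A)(i := (arr s A i)(j := r)))\<rparr>"

text \<open>
  One step evaluates at most a fixed number of expressions occurring in the program, hence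
  performs a number of elementary operations bounded by a constant depending on the program only.
  \<open>bernoulli_pmf\<close> truncates a bias outside \<open>[0,1]\<close> to that interval. \<open>Skip\<close> is the halted program.
\<close>

primrec step :: "com \<Rightarrow> store \<Rightarrow> (com \<times> store) pmf" where
  "step Skip s = return_pmf (Skip, s)"
| "step (NSet x a) s = return_pmf (Skip, set_cnt x (nval a s) s)"
| "step (RSet A i j r) s = return_pmf (Skip, set_arr A (nval i s) (nval j s) (rval r s) s)"
| "step (Flip x r) s =
     map_pmf (\<lambda>b. (Skip, set_cnt x (if b then 1 else 0) s)) (bernoulli_pmf (rval r s))"
| "step (Seq c d) s =
     (if c = Skip then return_pmf (d, s)
      else map_pmf (\<lambda>(c', s'). (Seq c' d, s')) (step c s))"
| "step (Cond b c d) s = return_pmf (if bval b s then c else d, s)"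
| "step (While b c) s = return_pmf (if bval b s then Seq c (While b c) else Skip, s)"

primrec run :: "nat \<Rightarrow> com \<times> store \<Rightarrow> (com \<times> store) pmf" where
  "run 0 cf = return_pmf cf"
| "run (Suc t) cf = bind_pmf (step (fst cf) (snd cf)) (run t)"

definition halts_within :: "nat \<Rightarrow> com \<Rightarrow> store \<Rightarrow> bool" where
  "halts_within t P s \<longleftrightarrow> (\<forall>cf \<in> set_pmf (run t (P, s)). fst cf = Skip)"

text \<open>
  Input: \<open>n\<close> and \<open>m\<close> in counters 0 and 1, the vectors \<open>v\<^sub>i\<close> as the rows of array 0, the starting
  point in column 0 of array 1. Output: column 0 of array 2.
\<close>

definition input :: "nat \<Rightarrow> nat \<Rightarrow> (nat \<Rightarrow> nat \<Rightarrow> real) \<Rightarrow> (nat \<Rightarrow> real) \<Rightarrow> store" where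
  "input n m v x\<^sub>0 =
     \<lparr> cnt = (\<lambda>k. if k = 0 then n else if k = 1 then m else 0),
       arr = (\<lambda>A i j. if A = 0 \<and> i < n \<and> j < m then v i j
                      else if A = 1 \<and> i < n \<and> j = 0 then x\<^sub>0 i
                      else 0) \<rparr>"

definition output_after :: "nat \<Rightarrow> com \<Rightarrow> store \<Rightarrow> (nat \<Rightarrow> real) pmf" where
  "output_after t P s = map_pmf (\<lambda>cf i. arr (snd cf) 2 i 0) (run t (P, s))"

end

theory Submission
  imports Defs
begin

text \<open>
  The algorithm is the Gram--Schmidt walk. Call \<open>i\<close> alive if \<open>\<bar>x i\<bar> < 1\<close>, let \<open>A\<close> be the set of alive
  indices and let the pivot \<open>p\<close> be its maximum. The walk moves along \<open>u\<close>, supported on \<open>A\<close> with \<open>u p = 1\<close>,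
  for which \<open>w = \<Sum>i. u i * v i\<close> is orthogonal to all other alive vectors; it goes in one of the two
  directions until a coordinate becomes frozen, with probabilities that make the step mean zero.

  Fix \<open>\<theta>\<close>, let \<open>N A\<close> be the squared norm of the projection of \<open>\<theta>\<close> onto the span of the alive vectors and
  \<open>a = \<langle>\<theta>, w\<rangle>\<close>. With \<open>Y\<close> the current discrepancy vector, the potential
  \<open>exp (\<langle>\<theta>, Y\<rangle> + c * (N A - a\<^sup>2) - a * x p) * (cosh a + x p * sinh a)\<close> is a supermartingale for \<open>c = 20\<close>.
  As long as \<open>A\<close> is unchanged it is affine in \<open>x p\<close>, hence a martingale. If the pivot survives but
  \<open>A\<close> shrinks to \<open>A'\<close> and \<open>a\<close> becomes \<open>a + b\<close>, then \<open>N A - a\<^sup>2\<close> drops by at least \<open>b\<^sup>2 + 2 * \<bar>a * b\<bar>\<close>, which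
  pays for the change of \<open>ln (cosh a + x p * sinh a) - a * x p\<close>, a function of \<open>a\<close> with derivative at
  most \<open>2 * \<bar>a\<bar>\<close>. If the pivot freezes, the last factor equals \<open>exp (a * x p)\<close>, and \<open>N A - a\<^sup>2\<close> bounds
  \<open>N\<close> of the remaining alive set. The potential starts below \<open>exp (20 * \<parallel>\<theta>\<parallel>\<^sup>2)\<close>, and \<open>20 = 40 / 2\<close>.
\<close>

section \<open>Timed execution of programs\<close>

text \<open>Asking for all \<open>t \<ge> T\<close>, not only for \<open>T\<close>, makes
  \<open>T\<close> an upper bound that can be weakened and that covers branches halting at different
  times.\<close>

definition exec :: "com \<Rightarrow> store \<Rightarrow> nat \<Rightarrow> store pmf \<Rightarrow> bool" where
  "exec c s T M \<longleftrightarrow> (\<forall>t\<ge>T. run t (c, s) = map_pmf (Pair Skip) M)"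

lemma run_Skip: "run t (Skip, s) = return_pmf (Skip, s)"
  by (induction t) (simp_all add: bind_return_pmf)

lemma exec_mono: "exec c s T M \<Longrightarrow> T \<le> T' \<Longrightarrow> exec c s T' M"
  by (auto simp: exec_def)

lemma exec_Skip: "exec Skip s T (return_pmf s)"
  by (simp add: exec_def run_Skip)

lemma exec_Suc:
  assumes "\<And>t. run (Suc t) (c, s) = map_pmf (Pair Skip) M"
  shows "exec c s 1 M"
  unfolding exec_def
proof (intro allI impI)
  fix t :: nat assume "1 \<le> t"
  then obtain t' where "t = Suc t'" by (cases t) auto
  then show "run t (c, s) = map_pmf (Pair Skip) M" using assms by blast
qed

lemma exec_NSet: "exec (NSet x a) s 1 (return_pmf (set_cnt x (nval a s) s))"
  by (rule exec_Suc) (simp add: bind_return_pmf run_Skip)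

lemma exec_RSet:
  "exec (RSet A i j r) s 1 (return_pmf (set_arr A (nval i s) (nval j s) (rval r s) s))"
  by (rule exec_Suc) (simp add: bind_return_pmf run_Skip)

lemma exec_Flip:
  "exec (Flip x r) s 1
     (map_pmf (\<lambda>b. set_cnt x (if b then 1 else 0) s) (bernoulli_pmf (rval r s)))"
  by (rule exec_Suc)
    (simp add: map_pmf_def bind_assoc_pmf bind_return_pmf run_Skip cong: bind_pmf_cong)

lemma exec_step:
  assumes "step c s = return_pmf (c', s)" and "exec c' s T M"
  shows "exec c s (Suc T) M"
  unfolding exec_def
proof (intro allI impI)
  fix t :: nat assume t: "Suc T \<le> t"
  then obtain t' where "t = Suc t'" by (cases t) auto
  then show "run t (c, s) = map_pmf (Pair Skip) M"
    using assms t by (simp add: exec_def bind_return_pmf)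
qed

text \<open>Induction on \<open>T\<close>, peeling off one step of \<open>c\<close>. Some branches
  of \<open>c\<close> halt early, so \<open>d\<close> must have its result at every time from
  \<open>T'\<close> on; the extra 1 pays for discarding the finished \<open>Skip\<close>.\<close>

lemma run_Seq:
  assumes "\<forall>cf \<in> set_pmf (run T (c, s)).
      fst cf = Skip \<and> (\<forall>t\<ge>T'. run t (d, snd cf) = F (snd cf))"
    and "t \<ge> T + 1 + T'"
  shows "run t (Seq c d, s) = bind_pmf (run T (c, s)) (\<lambda>cf. F (snd cf))"
  using assms
proof (induction T arbitrary: c s t)
  case 0
  then obtain t' where "t = Suc t'" by (cases t) auto
  with 0 show ?case by (simp add: bind_return_pmf)
next
  case (Suc T)
  then obtain t' where t: "t = Suc t'" by (cases t) auto
  show ?case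
  proof (cases "c = Skip")
    case True
    with Suc.prems t have "run t' (d, s) = F s"
      by (simp add: bind_return_pmf run_Skip)
    with True t show ?thesis by (simp add: bind_return_pmf run_Skip)
  next
    case False
    have "run t (Seq c d, s) = bind_pmf (step c s) (\<lambda>cf. run t' (Seq (fst cf) d, snd cf))"
      using False t by (simp add: map_pmf_def bind_assoc_pmf bind_return_pmf case_prod_beta)
    also have "\<dots> = bind_pmf (step c s) (\<lambda>cf. bind_pmf (run T cf) (\<lambda>cf. F (snd cf)))"
    proof (intro bind_pmf_cong refl)
      fix cf assume cf: "cf \<in> set_pmf (step c s)"
      show "run t' (Seq (fst cf) d, snd cf) = bind_pmf (run T cf) (\<lambda>cf. F (snd cf))"
        using Suc.IH[of "fst cf" "snd cf" t'] Suc.prems cf t by auto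
    qed
    also have "\<dots> = bind_pmf (run (Suc T) (c, s)) (\<lambda>cf. F (snd cf))"
      by (simp add: bind_assoc_pmf)
    finally show ?thesis .
  qed
qed

lemma exec_Seq:
  assumes "exec c s T M" and "\<And>s'. s' \<in> set_pmf M \<Longrightarrow> exec d s' T' (N s')"
  shows "exec (Seq c d) s (T + T' + 1) (bind_pmf M N)"
  unfolding exec_def
proof (intro allI impI)
  fix t assume "T + T' + 1 \<le> t"
  moreover have r: "run T (c, s) = map_pmf (Pair Skip) M"
    using assms(1) by (simp add: exec_def)
  ultimately have "run t (Seq c d, s)
      = bind_pmf (run T (c, s)) (\<lambda>cf. map_pmf (Pair Skip) (N (snd cf)))"
    using assms(2) by (intro run_Seq[where T' = T']) (auto simp: exec_def)
  then show "run t (Seq c d, s) = map_pmf (Pair Skip) (bind_pmf M N)"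
    by (simp add: r bind_map_pmf map_bind_pmf)
qed

text \<open>Meant to be evaluated at a common bound on the iterations of all loops, so that each
  loop contributes a factor \<open>[:0, 1:]\<close>. For \<open>Cond\<close> a sum replaces the
  maximum, which need not be a polynomial. An iteration costs 2 beyond its body: unfolding
  \<open>While\<close> and discarding \<open>Skip\<close>.\<close>

primrec cost :: "com \<Rightarrow> nat poly" where
  "cost Skip = 0"
| "cost (NSet x a) = 1"
| "cost (RSet A i j r) = 1"
| "cost (Flip x r) = 1"
| "cost (Seq c d) = cost c + cost d + 1"
| "cost (Cond b c d) = cost c + cost d + 1"
| "cost (While b c) = [:0, 1:] * (cost c + 2) + 1"

text \<open>A total-correctness triple with built-in time bound for code whose result is a point
  mass: copying, Gram-Schmidt, step lengths and moves.\<close>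

definition leads :: "nat \<Rightarrow> com \<Rightarrow> store \<Rightarrow> (store \<Rightarrow> bool) \<Rightarrow> bool" where
  "leads K c s Q \<longleftrightarrow> (\<exists>s'. exec c s (poly (cost c) K) (return_pmf s') \<and> Q s')"

lemma leads_mono: "leads K c s Q \<Longrightarrow> (\<And>s'. Q s' \<Longrightarrow> Q' s') \<Longrightarrow> leads K c s Q'"
  by (auto simp: leads_def)

lemma leads_Skip: "Q s \<Longrightarrow> leads K Skip s Q"
  by (auto simp: leads_def intro: exec_Skip)

lemma leads_NSet: "Q (set_cnt x (nval a s) s) \<Longrightarrow> leads K (NSet x a) s Q"
  using exec_NSet[of x a s] by (auto simp: leads_def)

lemma leads_RSet:
  "Q (set_arr A (nval i s) (nval j s) (rval r s) s) \<Longrightarrow> leads K (RSet A i j r) s Q"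
  using exec_RSet[of A i j r s] by (auto simp: leads_def)

lemma leads_Seq:
  assumes "leads K c s (\<lambda>s'. leads K d s' Q)"
  shows "leads K (Seq c d) s Q"
proof -
  obtain s' s'' where "exec c s (poly (cost c) K) (return_pmf s')"
    "exec d s' (poly (cost d) K) (return_pmf s'')" and Q: "Q s''"
    using assms by (auto simp: leads_def)
  then have "exec (Seq c d) s (poly (cost c) K + poly (cost d) K + 1)
      (bind_pmf (return_pmf s') (\<lambda>_. return_pmf s''))"
    by (intro exec_Seq) auto
  with Q show ?thesis by (auto simp: leads_def bind_return_pmf)
qed

lemma leads_Cond:
  assumes "bval b s \<Longrightarrow> leads K c s Q" and "\<not> bval b s \<Longrightarrow> leads K d s Q"
  shows "leads K (Cond b c d) s Q"
proof -
  obtain s' where s': "exec (if bval b s then c else d) s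
      (poly (cost (if bval b s then c else d)) K) (return_pmf s')" "Q s'"
    using assms by (cases "bval b s") (auto simp: leads_def)
  then have "exec (if bval b s then c else d) s (poly (cost c) K + poly (cost d) K) (return_pmf s')"
    by (auto elim!: exec_mono)
  then have "exec (Cond b c d) s (Suc (poly (cost c) K + poly (cost d) K)) (return_pmf s')"
    by (intro exec_step[where c' = "if bval b s then c else d"]) auto
  with s' show ?thesis by (auto simp: leads_def)
qed

definition For :: "nat \<Rightarrow> nexp \<Rightarrow> com \<Rightarrow> com" where
  "For x a c =
     Seq (NSet x (NConst 0))
       (While (NLess (NVar x) a) (Seq c (NSet x (NPlus (NVar x) (NConst 1)))))"

lemma exec_While_True:
  assumes "bval b s" and "exec c s T M"
    and "\<And>s'. s' \<in> set_pmf M \<Longrightarrow> exec (While b c) s' T' (N s')"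
  shows "exec (While b c) s (T + 2 + T') (bind_pmf M N)"
proof -
  have "exec (While b c) s (Suc (T + T' + 1)) (bind_pmf M N)"
    using assms by (intro exec_step[where c' = "Seq c (While b c)"] exec_Seq) auto
  then show ?thesis by simp
qed

lemma exec_While_False: "\<not> bval b s \<Longrightarrow> exec (While b c) s 1 (return_pmf s)"
  using exec_step[of "While b c" s Skip 0] by (simp add: exec_Skip)

text \<open>The body has to establish the invariant for the store with the counter already advanced,
  which settles the increment once and for all. \<open>N \<le> K\<close> makes the \<open>K\<close>
  iterations charged by \<open>cost\<close> suffice.\<close>

lemma leads_For:
  assumes init: "I 0 (set_cnt x 0 s)"
    and body: "\<And>k s. k < N \<Longrightarrow> cnt s x = k \<Longrightarrow> I k s \<Longrightarrow>
      leads K c s (\<lambda>s'. cnt s' x = k \<and> I (Suc k) (set_cnt x (Suc k) s'))"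
    and bound: "\<And>k s. I k s \<Longrightarrow> nval a s = N"
    and "N \<le> K"
    and exit: "\<And>s. cnt s x = N \<Longrightarrow> I N s \<Longrightarrow> Q s"
  shows "leads K (For x a c) s Q"
proof -
  define inc where "inc = Seq c (NSet x (NPlus (NVar x) (NConst 1)))"
  \<comment> \<open>Here \<open>r\<close> is the number of iterations still to come.\<close>
  have loop: "\<exists>s'. exec (While (NLess (NVar x) a) inc) s (r * (poly (cost inc) K + 2) + 1)
      (return_pmf s') \<and> Q s'"
    if "r \<le> N" "cnt s x = N - r" "I (N - r) s" for r s
    using that
  proof (induction r arbitrary: s)
    case 0
    then have "exec (While (NLess (NVar x) a) inc) s 1 (return_pmf s)"
      using bound by (intro exec_While_False) auto
    with 0 show ?case using exit by auto
  next
    case (Suc r)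
    then have "leads K inc s (\<lambda>s'. cnt s' x = N - r \<and> I (N - r) s')"
      unfolding inc_def
      by (intro leads_Seq leads_mono[OF body[of "N - Suc r" s]])
        (auto intro!: leads_NSet simp: set_cnt_def Suc_diff_Suc)
    then obtain s1 where s1: "exec inc s (poly (cost inc) K) (return_pmf s1)"
      "cnt s1 x = N - r" "I (N - r) s1"
      by (auto simp: leads_def)
    from Suc.IH[OF _ s1(2,3)] Suc.prems obtain s2 where
      s2: "exec (While (NLess (NVar x) a) inc) s1 (r * (poly (cost inc) K + 2) + 1) (return_pmf s2)"
      "Q s2" by auto
    have "bval (NLess (NVar x) a) s"
      using Suc.prems bound[OF Suc.prems(3)] by auto
    then have "exec (While (NLess (NVar x) a) inc) s
        (poly (cost inc) K + 2 + (r * (poly (cost inc) K + 2) + 1))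
        (bind_pmf (return_pmf s1) (\<lambda>_. return_pmf s2))"
      using s1 s2 by (intro exec_While_True) auto
    with s2 show ?case by (auto simp: bind_return_pmf algebra_simps)
  qed
  have "leads K (While (NLess (NVar x) a) inc) (set_cnt x 0 s) Q"
  proof -
    from loop[of N "set_cnt x 0 s"] init obtain s' where
      s': "exec (While (NLess (NVar x) a) inc) (set_cnt x 0 s)
        (N * (poly (cost inc) K + 2) + 1) (return_pmf s')" "Q s'"
      by (auto simp: set_cnt_def)
    moreover have "N * (poly (cost inc) K + 2) + 1
        \<le> poly (cost (While (NLess (NVar x) a) inc)) K"
      using mult_le_mono1[OF \<open>N \<le> K\<close>, of "poly (cost inc) K + 2"] by simp
    ultimately show ?thesis
      unfolding leads_def by (meson exec_mono)
  qed
  then show ?thesis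
    unfolding For_def inc_def[symmetric] by (intro leads_Seq leads_NSet) simp
qed

section \<open>Projections and walk directions\<close>

definition ip :: "nat \<Rightarrow> (nat \<Rightarrow> real) \<Rightarrow> (nat \<Rightarrow> real) \<Rightarrow> real" where
  "ip m f g = (\<Sum>k<m. f k * g k)"

lemma ip_commute: "ip m f g = ip m g f"
  by (simp add: ip_def mult.commute)

lemma ip_linear:
  "ip m (\<lambda>k. f k + g k) h = ip m f h + ip m g h"
  "ip m (\<lambda>k. f k - g k) h = ip m f h - ip m g h"
  "ip m (\<lambda>k. r * f k) h = r * ip m f h"
  "ip m h (\<lambda>k. f k + g k) = ip m h f + ip m h g"
  "ip m h (\<lambda>k. f k - g k) = ip m h f - ip m h g"
  "ip m h (\<lambda>k. r * f k) = r * ip m h f"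
  by (simp_all add: ip_def algebra_simps sum.distrib sum_subtractf sum_distrib_left)

lemma ip_cong: "(\<And>k. k < m \<Longrightarrow> f k = f' k) \<Longrightarrow> (\<And>k. k < m \<Longrightarrow> g k = g' k) \<Longrightarrow> ip m f g = ip m f' g'"
  by (simp add: ip_def)

lemma ip_nonneg: "0 \<le> ip m f f"
  by (simp add: ip_def sum_nonneg)

lemma ip_self_zero: "ip m f f = 0 \<Longrightarrow> ip m g f = 0"
  by (simp add: ip_def sum_nonneg_eq_0_iff)

lemma ip_L2_set: "ip m f f = (L2_set f {..<m})\<^sup>2"
  by (simp add: ip_def L2_set_def sum_nonneg power2_eq_square)

lemma ip_Cauchy_Schwarz: "(ip m f g)\<^sup>2 \<le> ip m f f * ip m g g"
proof -
  have "\<bar>ip m f g\<bar> \<le> (\<Sum>k<m. \<bar>f k\<bar> * \<bar>g k\<bar>)"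
    unfolding ip_def by (rule order_trans[OF sum_abs]) (simp add: abs_mult)
  also have "\<dots> \<le> L2_set f {..<m} * L2_set g {..<m}"
    by (rule L2_set_mult_ineq)
  finally have "\<bar>ip m f g\<bar>\<^sup>2 \<le> (L2_set f {..<m} * L2_set g {..<m})\<^sup>2"
    by (rule power_mono) simp
  then show ?thesis by (simp add: ip_L2_set power_mult_distrib)
qed

definition comb :: "nat \<Rightarrow> (nat \<Rightarrow> nat \<Rightarrow> real) \<Rightarrow> (nat \<Rightarrow> real) \<Rightarrow> nat \<Rightarrow> real" where
  "comb n v c = (\<lambda>k. \<Sum>i<n. c i * v i k)"

lemma comb_linear:
  "comb n v (\<lambda>i. c i + d i) = (\<lambda>k. comb n v c k + comb n v d k)"
  "comb n v (\<lambda>i. c i - d i) = (\<lambda>k. comb n v c k - comb n v d k)"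
  "comb n v (\<lambda>i. r * c i) = (\<lambda>k. r * comb n v c k)"
  by (simp_all add: comb_def fun_eq_iff algebra_simps sum.distrib sum_subtractf sum_distrib_left)

lemma ip_comb: "ip m f (comb n v c) = (\<Sum>i<n. c i * ip m f (v i))"
proof -
  have "ip m f (comb n v c) = (\<Sum>k<m. \<Sum>i<n. c i * (f k * v i k))"
    by (simp add: ip_def comb_def sum_distrib_left algebra_simps)
  also have "\<dots> = (\<Sum>i<n. c i * ip m f (v i))"
    by (subst sum.swap) (simp add: ip_def sum_distrib_left)
  finally show ?thesis .
qed

definition supp_in :: "nat set \<Rightarrow> (nat \<Rightarrow> real) \<Rightarrow> bool" where
  "supp_in S c \<longleftrightarrow> (\<forall>i. i \<notin> S \<longrightarrow> c i = 0)"

lemma ip_comb_orth: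
  assumes "supp_in S c" "\<And>i. i \<in> S \<Longrightarrow> ip m f (v i) = 0"
  shows "ip m f (comb n v c) = 0"
  unfolding ip_comb using assms by (intro sum.neutral) (auto simp: supp_in_def)

text \<open>This is \<open>ip m \<theta> \<theta>\<close> minus the squared distance from
  \<open>\<theta>\<close> to \<open>y\<close>; maximizing it over a subspace gives the squared norm
  of the projection without constructing the projection.\<close>

definition quad :: "nat \<Rightarrow> (nat \<Rightarrow> real) \<Rightarrow> (nat \<Rightarrow> real) \<Rightarrow> real" where
  "quad m \<theta> y = 2 * ip m \<theta> y - ip m y y"

lemma quad_le: "quad m \<theta> y \<le> ip m \<theta> \<theta>"
  using ip_nonneg[of m "\<lambda>k. \<theta> k - y k"] ip_commute[of m \<theta> y]
  by (simp add: ip_linear quad_def)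

text \<open>The squared norm of the orthogonal projection of \<open>\<theta>\<close> onto the span of the \<open>v i\<close> with
  \<open>i \<in> S\<close>, in variational form.\<close>

definition proj_sq :: "nat \<Rightarrow> nat \<Rightarrow> (nat \<Rightarrow> nat \<Rightarrow> real) \<Rightarrow> (nat \<Rightarrow> real) \<Rightarrow> nat set \<Rightarrow> real" where
  "proj_sq n m v \<theta> S = (SUP c\<in>{c. supp_in S c}. quad m \<theta> (comb n v c))"

lemma quad_le_proj_sq: "supp_in S c \<Longrightarrow> quad m \<theta> (comb n v c) \<le> proj_sq n m v \<theta> S"
  unfolding proj_sq_def
  by (intro cSUP_upper) (auto intro!: bdd_aboveI[where M = "ip m \<theta> \<theta>"] quad_le)

lemma proj_sq_leI:
  assumes "\<And>c. supp_in S c \<Longrightarrow> quad m \<theta> (comb n v c) \<le> R"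
  shows "proj_sq n m v \<theta> S \<le> R"
proof -
  have "supp_in S (\<lambda>_. 0)" by (simp add: supp_in_def)
  then show ?thesis unfolding proj_sq_def using assms by (intro cSUP_least) auto
qed

lemma proj_sq_le: "proj_sq n m v \<theta> S \<le> ip m \<theta> \<theta>"
  by (intro proj_sq_leI quad_le)

lemma proj_sq_mono: "S \<subseteq> S' \<Longrightarrow> proj_sq n m v \<theta> S \<le> proj_sq n m v \<theta> S'"
  by (intro proj_sq_leI quad_le_proj_sq) (auto simp: supp_in_def)

lemma proj_sq_nonneg: "0 \<le> proj_sq n m v \<theta> S"
proof -
  have "quad m \<theta> (comb n v (\<lambda>_. 0)) \<le> proj_sq n m v \<theta> S"
    by (intro quad_le_proj_sq) (simp add: supp_in_def)
  then show ?thesis by (simp add: quad_def comb_def ip_def)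
qed

text \<open>For indices below \<open>n\<close>, \<open>comb n v u\<close> is the component of
  \<open>v p\<close> orthogonal to the other vectors of \<open>A\<close>. It is unique, while
  \<open>u\<close> need not be if the vectors are dependent.\<close>

definition walk_dir :: "nat \<Rightarrow> nat \<Rightarrow> (nat \<Rightarrow> nat \<Rightarrow> real) \<Rightarrow> nat set \<Rightarrow> nat \<Rightarrow> (nat \<Rightarrow> real) \<Rightarrow> bool" where
  "walk_dir n m v A p u \<longleftrightarrow>
     supp_in A u \<and> u p = 1 \<and> (\<forall>j \<in> A - {p}. ip m (comb n v u) (v j) = 0)"

text \<open>By orthogonality only the pivot contributes to \<open>ip m w w\<close>, so it equals
  \<open>ip m w (v p)\<close>, and Cauchy-Schwarz applies.\<close>

lemma walk_dir_norm:
  assumes "walk_dir n m v A p u" "p < n" "ip m (v p) (v p) \<le> 1"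
  shows "ip m (comb n v u) (comb n v u) \<le> 1"
proof -
  let ?w = "comb n v u"
  have "ip m ?w ?w = (\<Sum>i<n. if i = p then ip m ?w (v p) else 0)"
    unfolding ip_comb[of m ?w n v u]
    using assms(1) by (intro sum.cong) (auto simp: walk_dir_def supp_in_def)
  also have "\<dots> = ip m ?w (v p)" using \<open>p < n\<close> by simp
  finally have eq: "ip m ?w ?w = ip m ?w (v p)" .
  have "(ip m ?w ?w)\<^sup>2 \<le> ip m ?w ?w * ip m (v p) (v p)"
    using ip_Cauchy_Schwarz[of m ?w "v p"] by (simp add: eq)
  also have "\<dots> \<le> ip m ?w ?w * 1"
    using assms(3) ip_nonneg by (intro mult_left_mono) auto
  finally have "ip m ?w ?w * ip m ?w ?w \<le> ip m ?w ?w * 1" by (simp add: power2_eq_square)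
  then show ?thesis
    using ip_nonneg[of m ?w]
    by (metis mult_le_cancel_left_pos linorder_not_le order_less_le zero_less_one order_trans)
qed

text \<open>The vector \<open>w = comb n v u\<close> is orthogonal to the remaining span, so adding
  \<open>\<mu> * w\<close> to any candidate there raises \<open>quad\<close> by
  \<open>2 * \<mu> * a - \<mu>\<^sup>2 * \<alpha>\<close>. The best \<open>\<mu>\<close> gains
  \<open>a\<^sup>2 / \<alpha>\<close>, and \<open>\<alpha> \<le> 1\<close>.\<close>

lemma proj_sq_remove_pivot:
  assumes "walk_dir n m v A p u" "p \<in> A" "p < n" "ip m (v p) (v p) \<le> 1"
  shows "proj_sq n m v \<theta> (A - {p}) + (ip m \<theta> (comb n v u))\<^sup>2 \<le> proj_sq n m v \<theta> A"
proof -
  define w where "w = comb n v u"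
  define a where "a = ip m \<theta> w"
  define \<alpha> where "\<alpha> = ip m w w"
  have \<alpha>: "0 \<le> \<alpha>" "\<alpha> \<le> 1"
    using walk_dir_norm[OF assms(1,3,4)] ip_nonneg by (auto simp: \<alpha>_def w_def)
  have "quad m \<theta> (comb n v c) \<le> proj_sq n m v \<theta> A - a\<^sup>2" if c: "supp_in (A - {p}) c" for c
  proof -
    have o: "ip m w (comb n v c) = 0"
      using assms(1) by (intro ip_comb_orth[OF c]) (auto simp: walk_dir_def w_def)
    \<comment> \<open>If \<open>\<alpha> = 0\<close>, division by zero gives
      \<open>\<mu> = 0\<close>, which is right because then \<open>a = 0\<close>.\<close>
    define \<mu> where "\<mu> = a / \<alpha>"
    have "supp_in A (\<lambda>i. c i + \<mu> * u i)"
      using c assms(1) by (auto simp: supp_in_def walk_dir_def)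
    from quad_le_proj_sq[OF this, of m \<theta> n v]
    have "quad m \<theta> (comb n v c) + (2 * \<mu> * a - \<mu>\<^sup>2 * \<alpha>) \<le> proj_sq n m v \<theta> A"
      using o ip_commute[of m w "comb n v c"]
      by (simp add: comb_linear ip_linear quad_def w_def[symmetric] a_def[symmetric]
          \<alpha>_def[symmetric] algebra_simps power2_eq_square)
    moreover have "a\<^sup>2 \<le> 2 * \<mu> * a - \<mu>\<^sup>2 * \<alpha>"
    proof (cases "\<alpha> = 0")
      case True
      then have "a = 0" unfolding a_def \<alpha>_def by (rule ip_self_zero)
      then show ?thesis by (simp add: \<mu>_def)
    next
      case False
      then have "2 * \<mu> * a - \<mu>\<^sup>2 * \<alpha> = a\<^sup>2 / \<alpha>"
        by (simp add: \<mu>_def field_simps power2_eq_square)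
      moreover have "a\<^sup>2 \<le> a\<^sup>2 / \<alpha>"
        using \<alpha> False by (simp add: le_divide_eq mult_left_le)
      ultimately show ?thesis by simp
    qed
    ultimately show ?thesis by simp
  qed
  then have "proj_sq n m v \<theta> (A - {p}) \<le> proj_sq n m v \<theta> A - a\<^sup>2"
    by (rule proj_sq_leI)
  then show ?thesis by (simp add: a_def w_def)
qed

text \<open>The optimal choices are \<open>\<mu> = a / \<alpha>\<close> and \<open>\<nu> = b / \<beta>\<close>. Against the single direction of squared
  length \<open>\<alpha> + \<beta>\<close> they gain \<open>(a * \<beta> - b * \<alpha>)\<^sup>2 / (\<alpha> * \<beta> * (\<alpha> + \<beta>))\<close>, which is at least
  \<open>4 * \<bar>a * b\<bar>\<close> if \<open>a\<close> and \<open>b\<close> have opposite signs.\<close>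

lemma two_direction_gain:
  fixes a b \<alpha> \<beta> \<kappa> :: real
  assumes "0 \<le> \<alpha>" "0 \<le> \<beta>" "\<alpha> + \<beta> \<le> 1" "\<alpha> = 0 \<Longrightarrow> a = 0" "\<beta> = 0 \<Longrightarrow> b = 0"
  shows "\<exists>\<mu> \<nu>. 2 * \<kappa> * (a + b) - \<kappa>\<^sup>2 * (\<alpha> + \<beta>) - (a + b)\<^sup>2 + a\<^sup>2 + \<bar>b\<bar> * (\<bar>b\<bar> + 2 * \<bar>a\<bar>)
    \<le> 2 * \<mu> * a - \<mu>\<^sup>2 * \<alpha> + 2 * \<nu> * b - \<nu>\<^sup>2 * \<beta>"
proof -
  have abs: "\<bar>b\<bar> * (\<bar>b\<bar> + 2 * \<bar>a\<bar>) = b\<^sup>2 + 2 * \<bar>a * b\<bar>"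
    by (simp add: algebra_simps abs_mult power2_eq_square)
  consider "\<alpha> = 0" | "\<beta> = 0" | "\<alpha> > 0" "\<beta> > 0" using assms by linarith
  then show ?thesis
  proof cases
    case 1
    with assms(4) show ?thesis
      unfolding abs by (intro exI[of _ 0] exI[of _ \<kappa>]) (simp add: algebra_simps)
  next
    case 2
    with assms(5) show ?thesis
      unfolding abs by (intro exI[of _ \<kappa>] exI[of _ 0]) (simp add: algebra_simps)
  next
    case 3
    have s: "\<alpha> + \<beta> > 0" using 3 by simp
    \<comment> \<open>Completing the square in \<open>\<kappa>\<close> bounds its contribution by
      \<open>(a + b)\<^sup>2 / (\<alpha> + \<beta>)\<close>.\<close>
    have "0 \<le> (\<kappa> * (\<alpha> + \<beta>) - (a + b))\<^sup>2 / (\<alpha> + \<beta>)" using s by simp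
    also have "\<dots> = (a + b)\<^sup>2 / (\<alpha> + \<beta>) - (2 * \<kappa> * (a + b) - \<kappa>\<^sup>2 * (\<alpha> + \<beta>))"
      using s by (simp add: field_simps power2_eq_square)
    finally have 1: "2 * \<kappa> * (a + b) - \<kappa>\<^sup>2 * (\<alpha> + \<beta>) \<le> (a + b)\<^sup>2 / (\<alpha> + \<beta>)" by simp
    have 2: "a\<^sup>2 / \<alpha> + b\<^sup>2 / \<beta> - (a + b)\<^sup>2 / (\<alpha> + \<beta>)
        = (a * \<beta> - b * \<alpha>)\<^sup>2 / (\<alpha> * \<beta> * (\<alpha> + \<beta>))"
      using 3 s by (simp add: divide_simps) (simp add: algebra_simps power2_eq_square)
    have 4: "2 * \<bar>a * b\<bar> - 2 * (a * b) \<le> (a * \<beta> - b * \<alpha>)\<^sup>2 / (\<alpha> * \<beta> * (\<alpha> + \<beta>))"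
    proof (cases "a * b \<ge> 0")
      case True
      then show ?thesis using 3 by simp
    next
      case False
      \<comment> \<open>The two sides differ by
        \<open>(a * \<beta> + b * \<alpha>)\<^sup>2\<close>.\<close>
      have "- 4 * (a * b) * (\<alpha> * \<beta>) \<le> (a * \<beta> - b * \<alpha>)\<^sup>2"
        using zero_le_power2[of "a * \<beta> + b * \<alpha>"] by (simp add: algebra_simps power2_eq_square)
      moreover have "- 4 * (a * b) * (\<alpha> * \<beta>) * (\<alpha> + \<beta>) \<le> - 4 * (a * b) * (\<alpha> * \<beta>) * 1"
        using False 3 assms(3) by (intro mult_left_mono) (auto simp: mult_nonpos_nonneg)
      ultimately have "- 4 * (a * b) * (\<alpha> * \<beta> * (\<alpha> + \<beta>)) \<le> (a * \<beta> - b * \<alpha>)\<^sup>2"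
        by (simp add: mult.assoc)
      then show ?thesis using False 3 s by (simp add: pos_le_divide_eq)
    qed
    have "2 * (a / \<alpha>) * a - (a / \<alpha>)\<^sup>2 * \<alpha> + 2 * (b / \<beta>) * b - (b / \<beta>)\<^sup>2 * \<beta> = a\<^sup>2 / \<alpha> + b\<^sup>2 / \<beta>"
      using 3 by (simp add: field_simps power2_eq_square)
    moreover have "(a + b)\<^sup>2 = a\<^sup>2 + b\<^sup>2 + 2 * (a * b)" by (simp add: power2_sum)
    ultimately show ?thesis
      unfolding abs using 1 2 4
      by (intro exI[of _ "a / \<alpha>"] exI[of _ "b / \<beta>"]) linarith
  qed
qed

text \<open>The pivot coefficients cancel in \<open>z\<close>, so \<open>z\<close> is orthogonal to
  \<open>w\<close> and the new walk vector \<open>w + z\<close> has squared length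
  \<open>\<alpha> + \<beta> \<le> 1\<close>. A candidate over \<open>A'\<close> uses only multiples
  of \<open>w + z\<close> besides vectors orthogonal to both; over \<open>A\<close> the two parts
  can be scaled independently, which \<open>two_direction_gain\<close> exploits.\<close>

lemma proj_sq_keep_pivot:
  fixes \<theta> :: "nat \<Rightarrow> real"
  assumes u: "walk_dir n m v A p u" and u': "walk_dir n m v A' p u'"
    and "A' \<subseteq> A" "p \<in> A'" "p < n" "ip m (v p) (v p) \<le> 1"
  defines "a \<equiv> ip m \<theta> (comb n v u)" and "a' \<equiv> ip m \<theta> (comb n v u')"
  shows "proj_sq n m v \<theta> A' - a'\<^sup>2 + \<bar>a' - a\<bar> * (\<bar>a' - a\<bar> + 2 * \<bar>a\<bar>) \<le> proj_sq n m v \<theta> A - a\<^sup>2"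
proof -
  define w z where "w = comb n v u" and "z = comb n v (\<lambda>i. u' i - u i)"
  define b \<alpha> \<beta> where "b = ip m \<theta> z" and "\<alpha> = ip m w w" and "\<beta> = ip m z z"
  have w': "comb n v u' = (\<lambda>k. w k + z k)" by (simp add: w_def z_def comb_linear)
  have a: "a = ip m \<theta> w" and a': "a' = a + b"
    by (simp_all add: a_def a'_def w_def[symmetric] w' ip_linear b_def)
  have sz: "supp_in (A - {p}) (\<lambda>i. u' i - u i)"
    using u u' \<open>A' \<subseteq> A\<close> by (auto simp: walk_dir_def supp_in_def)
  have wz: "ip m w z = 0" unfolding z_def
    using u by (intro ip_comb_orth[OF sz]) (auto simp: walk_dir_def w_def)
  have "ip m (comb n v u') (comb n v u') = \<alpha> + \<beta>"
    using wz ip_commute[of m z w] by (simp add: w' ip_linear \<alpha>_def \<beta>_def)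
  with walk_dir_norm[OF u'] assms have "\<alpha> + \<beta> \<le> 1" by simp
  have "quad m \<theta> (comb n v c)
      \<le> proj_sq n m v \<theta> A - a\<^sup>2 + a'\<^sup>2 - \<bar>b\<bar> * (\<bar>b\<bar> + 2 * \<bar>a\<bar>)" if c: "supp_in A' c" for c
  proof -
    \<comment> \<open>Splitting off the multiple \<open>c p\<close> of \<open>u'\<close> leaves
      coefficients vanishing at \<open>p\<close>, because \<open>u' p = 1\<close>.\<close>
    define c0 where "c0 = (\<lambda>i. c i - c p * u' i)"
    define y where "y = comb n v c0"
    have c0: "supp_in (A' - {p}) c0"
      using c u' by (auto simp: supp_in_def walk_dir_def c0_def)
    have yw: "ip m w y = 0" unfolding y_def
      using u \<open>A' \<subseteq> A\<close> by (intro ip_comb_orth[OF c0]) (auto simp: walk_dir_def w_def)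
    have "ip m (comb n v u') y = 0" unfolding y_def
      using u' by (intro ip_comb_orth[OF c0]) (auto simp: walk_dir_def)
    with yw have yz: "ip m z y = 0" by (simp add: w' ip_linear)
    have orth: "ip m w y = 0" "ip m y w = 0" "ip m z y = 0" "ip m y z = 0" "ip m w z = 0" "ip m z w = 0"
      using yw yz wz ip_commute[of m] by auto
    have "comb n v (\<lambda>i. c0 i + c p * u' i) = (\<lambda>k. y k + c p * (w k + z k))"
      by (simp only: comb_linear w' y_def)
    then have cy: "comb n v c = (\<lambda>k. y k + c p * (w k + z k))"
      by (simp add: c0_def)
    have qc: "quad m \<theta> (comb n v c) = quad m \<theta> y + (2 * c p * (a + b) - (c p)\<^sup>2 * (\<alpha> + \<beta>))"
      unfolding cy quad_def by (simp add: ip_linear orth a[symmetric] b_def[symmetric]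
          \<alpha>_def[symmetric] \<beta>_def[symmetric] algebra_simps power2_eq_square)
    obtain \<mu> \<nu> where mn: "2 * c p * (a + b) - (c p)\<^sup>2 * (\<alpha> + \<beta>) - (a + b)\<^sup>2 + a\<^sup>2
        + \<bar>b\<bar> * (\<bar>b\<bar> + 2 * \<bar>a\<bar>) \<le> 2 * \<mu> * a - \<mu>\<^sup>2 * \<alpha> + 2 * \<nu> * b - \<nu>\<^sup>2 * \<beta>"
      using two_direction_gain[of \<alpha> \<beta> a b "c p"] \<open>\<alpha> + \<beta> \<le> 1\<close> ip_nonneg ip_self_zero
      by (metis a \<alpha>_def b_def \<beta>_def)
    have "supp_in A (\<lambda>i. c0 i + \<mu> * u i + \<nu> * (u' i - u i))"
      using c0 u sz \<open>A' \<subseteq> A\<close> by (auto simp: supp_in_def walk_dir_def)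
    from quad_le_proj_sq[OF this, of m \<theta> n v]
    have "quad m \<theta> (\<lambda>k. y k + \<mu> * w k + \<nu> * z k) \<le> proj_sq n m v \<theta> A"
      unfolding comb_linear(1,3) z_def[symmetric] w_def[symmetric] y_def[symmetric] .
    moreover have "quad m \<theta> (\<lambda>k. y k + \<mu> * w k + \<nu> * z k)
        = quad m \<theta> y + (2 * \<mu> * a - \<mu>\<^sup>2 * \<alpha> + 2 * \<nu> * b - \<nu>\<^sup>2 * \<beta>)"
      unfolding quad_def by (simp add: ip_linear orth a[symmetric] b_def[symmetric]
          \<alpha>_def[symmetric] \<beta>_def[symmetric] algebra_simps power2_eq_square)
    ultimately show ?thesis using mn qc a' by simp
  qed
  then have "proj_sq n m v \<theta> A' \<le> proj_sq n m v \<theta> A - a\<^sup>2 + a'\<^sup>2 - \<bar>b\<bar> * (\<bar>b\<bar> + 2 * \<bar>a\<bar>)"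
    by (rule proj_sq_leI)
  then show ?thesis by (simp add: a')
qed

section \<open>Hyperbolic estimates\<close>

lemma abs_sinh_le_cosh: "\<bar>sinh t\<bar> \<le> cosh (t :: real)"
  by (simp add: abs_le_iff sinh_def cosh_def)

lemma abs_sinh_le: "\<bar>sinh t\<bar> \<le> \<bar>t\<bar> * cosh (t :: real)"
proof -
  have *: "sinh t \<le> t * cosh t" if pos: "0 < t" for t :: real
  proof -
    have "(sinh has_real_derivative cosh z) (at z)" for z :: real
      by (auto intro!: derivative_eq_intros)
    then obtain \<xi> where \<xi>: "0 < \<xi>" "\<xi> < t" "sinh t - sinh 0 = (t - 0) * cosh \<xi>"
      using MVT2[of 0 t sinh cosh] pos by auto
    with pos have "cosh \<xi> \<le> cosh t" by (subst cosh_real_nonneg_le_iff) auto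
    with \<xi> pos show ?thesis by simp
  qed
  show ?thesis
    using *[of t] *[of "- t"] by (cases t "0 :: real" rule: linorder_cases) auto
qed

text \<open>The logarithm of \<open>E [exp (a * (\<epsilon> - x))]\<close> for a sign \<open>\<epsilon>\<close> of mean \<open>x\<close>.\<close>

definition lcf :: "real \<Rightarrow> real \<Rightarrow> real" where
  "lcf x a = ln (cosh a + x * sinh a) - a * x"

text \<open>The factor \<open>1 - \<bar>x\<bar>\<close> is what cancels against
  \<open>1 - x\<^sup>2\<close> in the derivative of \<open>lcf\<close>, giving a bound uniform in
  \<open>x\<close>.\<close>

lemma cosh_plus_sinh_ge:
  assumes "\<bar>x\<bar> < (1::real)" shows "(1 - \<bar>x\<bar>) * cosh a \<le> cosh a + x * sinh a"
proof -
  have "\<bar>x * sinh a\<bar> \<le> \<bar>x\<bar> * cosh a"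
    unfolding abs_mult by (intro mult_left_mono abs_sinh_le_cosh) auto
  then show ?thesis by (simp add: algebra_simps)
qed

lemma cosh_plus_sinh_pos:
  assumes "\<bar>x\<bar> < (1::real)" shows "0 < cosh a + x * sinh a"
proof -
  have "0 < (1 - \<bar>x\<bar>) * cosh a" using assms by (simp add: cosh_real_pos)
  then show ?thesis using cosh_plus_sinh_ge[OF assms, of a] by linarith
qed

text \<open>The derivative of \<open>lcf x\<close> at \<open>t\<close> is
  \<open>(1 - x\<^sup>2) * sinh t / (cosh t + x * sinh t)\<close>, at most
  \<open>2 * \<bar>t\<bar>\<close> in absolute value, and
  \<open>\<bar>t\<bar> \<le> \<bar>a' - a\<bar> + \<bar>a\<bar>\<close> between \<open>a\<close> and
  \<open>a'\<close>.\<close>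

lemma lcf_diff_le:
  assumes x: "\<bar>x\<bar> < 1"
  shows "lcf x a' - lcf x a \<le> 2 * (\<bar>a' - a\<bar> * (\<bar>a' - a\<bar> + \<bar>a\<bar>))"
proof -
  define g where "g t = (sinh t + x * cosh t) / (cosh t + x * sinh t) - x" for t
  have der: "(lcf x has_real_derivative g t) (at t)" for t
    unfolding lcf_def g_def using cosh_plus_sinh_pos[OF x, of t]
    by (auto intro!: derivative_eq_intros simp: field_simps)
  have g: "\<bar>g t\<bar> \<le> 2 * \<bar>t\<bar>" for t
  proof -
    have pos: "0 < cosh t + x * sinh t" by (rule cosh_plus_sinh_pos[OF x])
    have "g t = (1 - x\<^sup>2) * sinh t / (cosh t + x * sinh t)"
      using pos by (simp add: g_def field_simps power2_eq_square)
    moreover have "\<bar>(1 - x\<^sup>2) * sinh t\<bar> \<le> 2 * \<bar>t\<bar> * (cosh t + x * sinh t)"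
    proof -
      have "1 - x\<^sup>2 = (1 - \<bar>x\<bar>) * (1 + \<bar>x\<bar>)" by (simp add: algebra_simps power2_eq_square)
      then have "\<bar>(1 - x\<^sup>2) * sinh t\<bar> = (1 + \<bar>x\<bar>) * ((1 - \<bar>x\<bar>) * \<bar>sinh t\<bar>)"
        using x by (simp add: abs_mult)
      also have "\<dots> \<le> 2 * ((1 - \<bar>x\<bar>) * (\<bar>t\<bar> * cosh t))"
        using x by (intro mult_mono mult_left_mono abs_sinh_le) auto
      also have "\<dots> = 2 * \<bar>t\<bar> * ((1 - \<bar>x\<bar>) * cosh t)" by simp
      also have "\<dots> \<le> 2 * \<bar>t\<bar> * (cosh t + x * sinh t)"
        by (intro mult_left_mono cosh_plus_sinh_ge[OF x]) auto
      finally show ?thesis .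
    qed
    ultimately show ?thesis using pos by (simp add: abs_divide abs_of_pos[OF pos] pos_divide_le_eq)
  qed
  have "norm (lcf x a' - lcf x a) \<le> 2 * (\<bar>a' - a\<bar> + \<bar>a\<bar>) * norm (a' - a)"
  proof (rule field_differentiable_bound[where S = "closed_segment a a'" and f' = g])
    fix t assume t: "t \<in> closed_segment a a'"
    then have "\<bar>t\<bar> \<le> \<bar>a' - a\<bar> + \<bar>a\<bar>" by (auto simp: closed_segment_eq_real_ivl split: if_splits)
    then show "norm (g t) \<le> 2 * (\<bar>a' - a\<bar> + \<bar>a\<bar>)" using g[of t] by simp
    show "(lcf x has_field_derivative g t) (at t within closed_segment a a')"
      using der has_field_derivative_at_within by blast
  qed auto
  moreover have "2 * (r + q) * r = 2 * (r * (r + q))" for r q :: real by simp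
  ultimately show ?thesis unfolding real_norm_def by (metis abs_le_D1)
qed

section \<open>The potential and its change in one move\<close>

definition alive :: "nat \<Rightarrow> (nat \<Rightarrow> real) \<Rightarrow> nat set" where
  "alive n x = {i. i < n \<and> \<bar>x i\<bar> < 1}"

lemma finite_alive: "finite (alive n x)"
  by (simp add: alive_def)

text \<open>One test vector \<open>\<theta>\<close> is fixed for the analysis; the program never
  sees it, and all \<open>\<theta>\<close> are treated at the end.\<close>

locale walk =
  fixes n m :: nat and v :: "nat \<Rightarrow> nat \<Rightarrow> real" and x\<^sub>0 \<theta> :: "nat \<Rightarrow> real"
  assumes norm_le: "\<And>i. i < n \<Longrightarrow> ip m (v i) (v i) \<le> 1"
begin

definition disc :: "(nat \<Rightarrow> real) \<Rightarrow> real" where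
  "disc x = ip m \<theta> (comb n v (\<lambda>i. x i - x\<^sub>0 i))"

definition proj :: "(nat \<Rightarrow> real) \<Rightarrow> real" where
  "proj x = proj_sq n m v \<theta> (alive n x)"

definition pivot :: "(nat \<Rightarrow> real) \<Rightarrow> nat" where
  "pivot x = Max (alive n x)"

definition dir :: "(nat \<Rightarrow> real) \<Rightarrow> (nat \<Rightarrow> real) \<Rightarrow> bool" where
  "dir x u \<longleftrightarrow> walk_dir n m v (alive n x) (pivot x) u"

definition drift :: "(nat \<Rightarrow> real) \<Rightarrow> real" where
  "drift u = ip m \<theta> (comb n v u)"

definition pot :: "(nat \<Rightarrow> real) \<Rightarrow> (nat \<Rightarrow> real) \<Rightarrow> real" where
  "pot x u = exp (disc x + 20 * (proj x - (drift u)\<^sup>2) + lcf (x (pivot x)) (drift u))"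

text \<open>Directions are quantified universally here, so that neither their existence nor their uniqueness
  is ever needed.\<close>

definition pot_le :: "(nat \<Rightarrow> real) \<Rightarrow> real \<Rightarrow> bool" where
  "pot_le x R \<longleftrightarrow>
     (if alive n x = {} then exp (disc x) \<le> R else \<forall>u. dir x u \<longrightarrow> pot x u \<le> R)"

lemma pot_le_mono: "pot_le x R \<Longrightarrow> R \<le> R' \<Longrightarrow> pot_le x R'"
  unfolding pot_le_def by (metis order_trans)

lemma pivot_alive:
  assumes "alive n x \<noteq> {}"
  shows "pivot x \<in> alive n x" "pivot x < n" "\<bar>x (pivot x)\<bar> < 1"
proof -
  show "pivot x \<in> alive n x" using Max_in[OF finite_alive assms] by (simp add: pivot_def)
  then show "pivot x < n" "\<bar>x (pivot x)\<bar> < 1" by (auto simp: alive_def)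
qed

text \<open>Comparing drift \<open>a\<close> with drift 0, where \<open>lcf\<close> vanishes, gives
  \<open>lcf \<le> 2 * a\<^sup>2\<close>, which the term \<open>- 20 * a\<^sup>2\<close> absorbs.
  This starts the potential for any new pivot, initially and after the old one freezes.\<close>

lemma pot_le_proj: "pot_le x (exp (disc x + 20 * proj x))"
proof (cases "alive n x = {}")
  case True
  then show ?thesis by (simp add: pot_le_def proj_def proj_sq_nonneg)
next
  case False
  have "lcf (x (pivot x)) a \<le> 20 * a\<^sup>2" for a
  proof -
    have "lcf (x (pivot x)) a \<le> 2 * \<bar>a\<bar> * \<bar>a\<bar>"
      using lcf_diff_le[OF pivot_alive(3)[OF False], of a 0] by (simp add: lcf_def)
    also have "\<dots> = 2 * a\<^sup>2" by (simp add: power2_eq_square)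
    also have "\<dots> \<le> 20 * a\<^sup>2" by simp
    finally show ?thesis .
  qed
  with False show ?thesis by (simp add: pot_le_def pot_def)
qed

lemma pot_le_initial: "pot_le x\<^sub>0 (exp (20 * ip m \<theta> \<theta>))"
proof -
  have "disc x\<^sub>0 = 0" by (simp add: disc_def comb_def ip_def)
  then have "exp (disc x\<^sub>0 + 20 * proj x\<^sub>0) \<le> exp (20 * ip m \<theta> \<theta>)"
    by (simp add: proj_def proj_sq_le)
  with pot_le_proj show ?thesis by (rule pot_le_mono)
qed

text \<open>The potential after a move, as a function of the new pivot coordinate \<open>y\<close>; it is affine because
  moving by \<open>\<delta>\<close> changes both \<open>disc x\<close> and \<open>drift u * x (pivot x)\<close> by \<open>\<delta> * drift u\<close>.\<close>

definition pot_line :: "(nat \<Rightarrow> real) \<Rightarrow> (nat \<Rightarrow> real) \<Rightarrow> real \<Rightarrow> real" where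
  "pot_line x u y = exp (disc x + 20 * (proj x - (drift u)\<^sup>2) - drift u * x (pivot x))
     * (cosh (drift u) + y * sinh (drift u))"

lemma pot_line_pivot:
  assumes "alive n x \<noteq> {}"
  shows "pot_line x u (x (pivot x)) = pot x u"
  using cosh_plus_sinh_pos[OF pivot_alive(3)[OF assms], of "drift u"]
  by (simp add: pot_line_def pot_def lcf_def exp_add exp_diff)

lemma alive_move:
  assumes "dir x u" "\<And>i. i < n \<Longrightarrow> \<bar>x i\<bar> \<le> 1"
  shows "alive n (\<lambda>i. x i + \<delta> * u i) \<subseteq> alive n x"
  using assms by (auto simp: alive_def dir_def walk_dir_def supp_in_def)

lemma disc_move: "disc (\<lambda>i. x i + \<delta> * u i) = disc x + \<delta> * drift u"
proof -
  have "(\<lambda>i. x i + \<delta> * u i - x\<^sub>0 i) = (\<lambda>i. (x i - x\<^sub>0 i) + \<delta> * u i)" by auto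
  then show ?thesis by (simp add: disc_def drift_def comb_linear(1,3) ip_linear)
qed

text \<open>Along the line the potential is computed with the old projection and drift. If the pivot
  survives, \<open>proj_sq_keep_pivot\<close> pays for updating them; if it freezes,
  \<open>proj_sq_remove_pivot\<close> leaves enough to start with a new pivot.\<close>

lemma pot_le_move:
  assumes ne: "alive n x \<noteq> {}" and u: "dir x u"
    and x: "\<And>i. i < n \<Longrightarrow> \<bar>x i\<bar> \<le> 1"
    and x': "\<And>i. i < n \<Longrightarrow> \<bar>x i + \<delta> * u i\<bar> \<le> 1"
  shows "pot_le (\<lambda>i. x i + \<delta> * u i) (pot_line x u (x (pivot x) + \<delta>))"
proof -
  define p a where "p = pivot x" and "a = drift u"
  define y where "y = (\<lambda>i. x i + \<delta> * u i)"
  have p: "p \<in> alive n x" "p < n" "u p = 1"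
    using pivot_alive[OF ne] u by (auto simp: p_def dir_def walk_dir_def)
  have yp: "y p = x p + \<delta>" using p by (simp add: y_def)
  have sub: "alive n y \<subseteq> alive n x" unfolding y_def by (rule alive_move[OF u x])
  have dy: "disc y = disc x + \<delta> * a" by (simp add: y_def a_def disc_move)
  have line: "pot_line x u (y p) = exp (disc y + 20 * (proj x - a\<^sup>2) - a * y p) * (cosh a + y p * sinh a)"
    by (simp add: pot_line_def dy yp a_def[symmetric] p_def[symmetric] algebra_simps)
  have "pot_le y (pot_line x u (y p))"
  proof (cases "\<bar>y p\<bar> < 1")
    case True
    then have py: "p \<in> alive n y" using p by (simp add: alive_def)
    \<comment> \<open>No index becomes alive again, so a surviving maximum stays the
      maximum.\<close>
    have pivot: "pivot y = p"
      unfolding pivot_def using py sub finite_alive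
      by (intro Max_eqI) (auto simp: p_def pivot_def)
    have "pot y u' \<le> pot_line x u (y p)" if u': "dir y u'" for u'
    proof -
      define a' where "a' = drift u'"
      have 1: "proj y - a'\<^sup>2 + \<bar>a' - a\<bar> * (\<bar>a' - a\<bar> + 2 * \<bar>a\<bar>) \<le> proj x - a\<^sup>2"
        unfolding proj_def a_def a'_def drift_def
        using u u' py p norm_le sub
        by (intro proj_sq_keep_pivot[where p = p]) (auto simp: dir_def pivot p_def)
      have 2: "lcf (y p) a' - lcf (y p) a \<le> 2 * (\<bar>a' - a\<bar> * (\<bar>a' - a\<bar> + \<bar>a\<bar>))"
        by (rule lcf_diff_le[OF True])
      have "\<bar>a' - a\<bar> * (\<bar>a' - a\<bar> + \<bar>a\<bar>) \<le> \<bar>a' - a\<bar> * (\<bar>a' - a\<bar> + 2 * \<bar>a\<bar>)"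
        "0 \<le> \<bar>a' - a\<bar> * (\<bar>a' - a\<bar> + 2 * \<bar>a\<bar>)"
        by (intro mult_left_mono) auto
      \<comment> \<open>The drop \<open>Q\<close> of the projection term counts 20 times, whereas
        \<open>lcf\<close> rises by at most \<open>2 * S \<le> 2 * Q\<close>.\<close>
      moreover have "P + Q \<le> P' \<Longrightarrow> l' - l \<le> 2 * S \<Longrightarrow> S \<le> Q \<Longrightarrow> 0 \<le> Q \<Longrightarrow> 20 * P + l' \<le> 20 * P' + l"
        for P P' Q S l l' :: real by linarith
      ultimately have "20 * (proj y - a'\<^sup>2) + lcf (y p) a' \<le> 20 * (proj x - a\<^sup>2) + lcf (y p) a"
        using 1 2 by blast
      then have "pot y u' \<le> exp (disc y + 20 * (proj x - a\<^sup>2) + lcf (y p) a)"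
        by (simp add: pot_def pivot a'_def)
      also have "\<dots> = pot_line x u (y p)"
        using cosh_plus_sinh_pos[OF True, of a] by (simp add: line lcf_def exp_add exp_diff)
      finally show ?thesis .
    qed
    with py show ?thesis by (auto simp: pot_le_def)
  next
    case False
    then have "y p = 1 \<or> y p = -1" using x'[OF p(2)] by (auto simp: y_def)
    \<comment> \<open>At an end point the hyperbolic factor is \<open>exp a\<close> or
      \<open>exp (- a)\<close>, that is, \<open>exp (a * y p)\<close>.\<close>
    then have "exp (- (a * y p)) * (cosh a + y p * sinh a) = 1"
      by (auto simp: cosh_plus_sinh cosh_minus_sinh simp flip: exp_add)
    moreover have "pot_line x u (y p)
        = exp (disc y + 20 * (proj x - a\<^sup>2)) * (exp (- (a * y p)) * (cosh a + y p * sinh a))"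
      unfolding line mult.assoc[symmetric] exp_add[symmetric] by simp
    ultimately have l: "pot_line x u (y p) = exp (disc y + 20 * (proj x - a\<^sup>2))"
      by simp
    have "proj y \<le> proj_sq n m v \<theta> (alive n x - {p})"
      unfolding proj_def using sub False by (intro proj_sq_mono) (auto simp: alive_def)
    also have "\<dots> \<le> proj x - a\<^sup>2"
      using proj_sq_remove_pivot[of n m v "alive n x" p u \<theta>] u p norm_le
      by (simp add: proj_def a_def drift_def dir_def p_def)
    finally have "exp (disc y + 20 * proj y) \<le> pot_line x u (y p)" by (simp add: l)
    with pot_le_proj show ?thesis by (rule pot_le_mono)
  qed
  then show ?thesis by (simp add: yp p_def[symmetric] flip: y_def)
qed

text \<open>Steps \<open>d\<close> and \<open>- e\<close> with these weights have mean zero, and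
  \<open>pot_line\<close> is affine in its last argument.\<close>

lemma pot_line_mean:
  assumes "0 < d" "0 < e"
  shows "e / (d + e) * pot_line x u (y + d) + (1 - e / (d + e)) * pot_line x u (y - e)
    = pot_line x u y"
proof -
  define K where "K = exp (disc x + 20 * (proj x - (drift u)\<^sup>2) - drift u * x (pivot x))"
  have "d + e \<noteq> 0" using assms by simp
  then show ?thesis unfolding pot_line_def K_def[symmetric]
    by (simp add: divide_simps) (simp add: algebra_simps)
qed

end

section \<open>The program\<close>

lemma set_cnt_simps [simp]:
  "cnt (set_cnt x k s) = (cnt s)(x := k)" "arr (set_cnt x k s) = arr s"
  by (simp_all add: set_cnt_def)

lemma set_arr_simps [simp]:
  "cnt (set_arr A i j r s) = cnt s"
  "arr (set_arr A i j r s) = (arr s)(A := (arr s A)(i := (arr s A i)(j := r)))"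
  by (simp_all add: set_arr_def)

text \<open>A frame condition: \<open>C\<close> and \<open>A\<close> list what may have been
  overwritten.\<close>

definition same :: "nat set \<Rightarrow> nat set \<Rightarrow> store \<Rightarrow> store \<Rightarrow> bool" where
  "same C A s s' \<longleftrightarrow> (\<forall>c. c \<notin> C \<longrightarrow> cnt s' c = cnt s c) \<and> (\<forall>B. B \<notin> A \<longrightarrow> arr s' B = arr s B)"

text \<open>The value of \<open>r\<close> is only asked for while entries from \<open>k\<close> on
  are still old, so \<open>r\<close> may read the entry that it replaces, as orthogonalization in
  place does.\<close>

lemma leads_fill_row:
  fixes f :: "nat \<Rightarrow> real" and E :: "nat \<Rightarrow> nat \<Rightarrow> real" and i :: nat
  defines "filled \<equiv> \<lambda>k l. if l < k then f l else E i l"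
  assumes E: "arr s 3 = E" "cnt s 3 = i"
    and r: "\<And>k s'. k < N \<Longrightarrow> same {5} {3} s s' \<Longrightarrow> cnt s' 5 = k \<Longrightarrow>
      arr s' 3 = E(i := filled k) \<Longrightarrow> rval r s' = f k"
    and N: "cnt s 1 + cnt s 0 = N" "N \<le> K"
  shows "leads K (For 5 (NPlus (NVar 1) (NVar 0)) (RSet 3 (NVar 3) (NVar 5) r)) s
    (\<lambda>s'. same {5} {3} s s' \<and> arr s' 3 = E(i := filled N))"
proof (rule leads_For[where N = N and
      I = "\<lambda>k s'. same {5} {3} s s' \<and> arr s' 3 = E(i := filled k)"])
  show "same {5} {3} s (set_cnt 5 0 s) \<and> arr (set_cnt 5 0 s) 3 = E(i := filled 0)"
    using E by (auto simp: same_def filled_def)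
next
  fix k s' assume k: "k < N" "cnt s' 5 = k"
    and s': "same {5} {3} s s' \<and> arr s' 3 = E(i := filled k)"
  have "rval r s' = f k" using r[OF k(1) _ k(2)] s' by blast
  moreover have "(filled k)(k := f k) = filled (Suc k)" by (auto simp: filled_def)
  ultimately show "leads K (RSet 3 (NVar 3) (NVar 5) r) s' (\<lambda>s'. cnt s' 5 = k \<and>
      same {5} {3} s (set_cnt 5 (Suc k) s') \<and>
      arr (set_cnt 5 (Suc k) s') 3 = E(i := filled (Suc k)))"
    using k s' E by (intro leads_RSet) (simp add: same_def)
qed (use N in \<open>auto simp: same_def\<close>)

lemma leads_fill_col:
  fixes s :: store and f :: "nat \<Rightarrow> real"
  defines "filled \<equiv> \<lambda>k i. if i < k then (arr s 2 i)(0 := f i) else arr s 2 i"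
  assumes r: "\<And>k s'. k < N \<Longrightarrow> same {3} {2} s s' \<Longrightarrow> cnt s' 3 = k \<Longrightarrow> arr s' 2 k = arr s 2 k \<Longrightarrow>
      rval r s' = f k"
    and N: "cnt s 0 = N" "N \<le> K"
  shows "leads K (For 3 (NVar 0) (RSet 2 (NVar 3) (NConst 0) r)) s
    (\<lambda>s'. same {3} {2} s s' \<and> arr s' 2 = filled N)"
proof (rule leads_For[where N = N and I = "\<lambda>k s'. same {3} {2} s s' \<and> arr s' 2 = filled k"])
  show "same {3} {2} s (set_cnt 3 0 s) \<and> arr (set_cnt 3 0 s) 2 = filled 0"
    by (simp add: same_def filled_def)
next
  fix k s' assume k: "k < N" "cnt s' 3 = k" and s': "same {3} {2} s s' \<and> arr s' 2 = filled k"
  have "arr s' 2 k = arr s 2 k" using s' by (simp add: filled_def)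
  then have "rval r s' = f k" using r[OF k(1) _ k(2)] s' by blast
  moreover have "(filled k)(k := (filled k k)(0 := f k)) = filled (Suc k)" by (auto simp: filled_def fun_eq_iff)
  ultimately show "leads K (RSet 2 (NVar 3) (NConst 0) r) s' (\<lambda>s'. cnt s' 3 = k \<and>
      same {3} {2} s (set_cnt 3 (Suc k) s') \<and> arr (set_cnt 3 (Suc k) s') 2 = filled (Suc k))"
    using k s' by (intro leads_RSet) (simp add: same_def)
qed (use N in \<open>auto simp: same_def\<close>)

text \<open>Counters: 2 rounds, 3 to 5 loop indices, 6 the pivot, 7 the coin. Array 2 holds the current point.
  Row \<open>i\<close> of array 3 is a vector of length \<open>m + n\<close>: the \<open>i\<close>-th Gram--Schmidt vector, followed by its
  coefficients with respect to the \<open>v j\<close>. Rows of frozen indices are zero, and since \<open>x / 0 = 0\<close>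
  neither they nor linearly dependent rows need a special case.\<close>

abbreviation pos_exp :: rexp where
  "pos_exp \<equiv> RGet 2 (NVar 3) (NConst 0)"

abbreviation dir_exp :: rexp where
  "dir_exp \<equiv> RGet 3 (NVar 6) (NPlus (NVar 1) (NVar 3))"

abbreviation scratch :: "nat \<Rightarrow> rexp" where
  "scratch q \<equiv> RGet 4 (NConst 0) (NConst q)"

abbreviation set_scratch :: "nat \<Rightarrow> rexp \<Rightarrow> com" where
  "set_scratch q r \<equiv> RSet 4 (NConst 0) (NConst q) r"

text \<open>Array 0 is zero from column \<open>m\<close> on, so copying \<open>m + n\<close> entries
  also clears the coefficients before the own one is set to 1. Rows are visited in ascending order,
  hence counter 6 ends at the largest alive index.\<close>

definition init_row :: com where
  "init_row =
     Cond (BAnd (RLess (RConst (-1)) pos_exp) (RLess pos_exp (RConst 1)))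
       (Seq (For 5 (NPlus (NVar 1) (NVar 0)) (RSet 3 (NVar 3) (NVar 5) (RGet 0 (NVar 3) (NVar 5))))
         (Seq (RSet 3 (NVar 3) (NPlus (NVar 1) (NVar 3)) (RConst 1)) (NSet 6 (NVar 3))))
       (For 5 (NPlus (NVar 1) (NVar 0)) (RSet 3 (NVar 3) (NVar 5) (RConst 0)))"

text \<open>Inner products use the first \<open>m\<close> entries only, but the subtraction covers
  all \<open>m + n\<close>, so the coefficients follow the vector.\<close>

definition orth_row :: com where
  "orth_row =
     Seq (set_scratch 0 (RConst 0)) (Seq (set_scratch 1 (RConst 0))
     (Seq (For 5 (NVar 1)
       (Seq (set_scratch 0 (RPlus (scratch 0)
              (RTimes (RGet 3 (NVar 3) (NVar 5)) (RGet 3 (NVar 4) (NVar 5)))))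
            (set_scratch 1 (RPlus (scratch 1)
              (RTimes (RGet 3 (NVar 4) (NVar 5)) (RGet 3 (NVar 4) (NVar 5)))))))
     (For 5 (NPlus (NVar 1) (NVar 0))
       (RSet 3 (NVar 3) (NVar 5) (RMinus (RGet 3 (NVar 3) (NVar 5))
         (RTimes (RDiv (scratch 0) (scratch 1)) (RGet 3 (NVar 4) (NVar 5))))))))"

definition gram_schmidt :: com where
  "gram_schmidt = For 3 (NVar 0) (Seq init_row (For 4 (NVar 3) orth_row))"

text \<open>The largest step along \<open>u\<close> that stays in the cube. The initial value 2 is never the result if some
  coordinate is alive, because the direction is 1 or -1 at the pivot.\<close>

definition reach :: "nat \<Rightarrow> rexp \<Rightarrow> com" where
  "reach q u =
     Seq (set_scratch q (RConst 2))
       (For 3 (NVar 0)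
         (Cond (RLess (RConst 0) u)
           (Cond (RLess (RDiv (RMinus (RConst 1) pos_exp) u) (scratch q))
             (set_scratch q (RDiv (RMinus (RConst 1) pos_exp) u)) Skip)
           (Cond (RLess u (RConst 0))
             (Cond (RLess (RDiv (RMinus (RConst (-1)) pos_exp) u) (scratch q))
               (set_scratch q (RDiv (RMinus (RConst (-1)) pos_exp) u)) Skip)
             Skip)))"

text \<open>Counter 6 stays 0 if nothing is alive; row 0 is then zero, and so is the
  direction.\<close>

definition prepare :: com where
  "prepare = Seq (NSet 6 (NConst 0))
     (Seq gram_schmidt (Seq (reach 2 dir_exp) (reach 3 (RMinus (RConst 0) dir_exp))))"

definition move :: com where
  "move = Seq (Cond (NLess (NConst 0) (NVar 7)) Skip
       (set_scratch 2 (RMinus (RConst 0) (scratch 3))))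
     (For 3 (NVar 0) (RSet 2 (NVar 3) (NConst 0) (RPlus pos_exp (RTimes (scratch 2) dir_exp))))"

text \<open>With step lengths \<open>d\<close> forward and \<open>e\<close> backward the bias is
  \<open>e / (d + e)\<close>, which makes the step mean zero.\<close>

definition walk_round :: com where
  "walk_round = Seq prepare
     (Seq (Flip 7 (RDiv (scratch 3) (RPlus (scratch 2) (scratch 3)))) move)"

definition copy_start :: com where
  "copy_start = For 3 (NVar 0) (RSet 2 (NVar 3) (NConst 0) (RGet 1 (NVar 3) (NConst 0)))"

text \<open>Every round freezes a coordinate as long as one is alive, so \<open>n\<close> rounds
  suffice; later rounds leave the point where it is.\<close>

definition gram_schmidt_walk :: com where
  "gram_schmidt_walk = Seq copy_start (For 2 (NVar 0) walk_round)"

section \<open>Correctness of the Gram-Schmidt phase\<close>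

lemma leads_orth_row:
  assumes "arr s 3 = E" "cnt s 3 = i" "cnt s 4 = j" "cnt s 0 = n" "cnt s 1 = m" "i \<noteq> j"
  shows "leads (n + m) orth_row s (\<lambda>s'. same {5} {3, 4} s s' \<and> arr s' 3 = E(i :=
    (\<lambda>k. if k < m + n then E i k - ip m (E i) (E j) / ip m (E j) (E j) * E j k else E i k)))"
proof -
  have dots: "leads (n + m) (For 5 (NVar 1)
       (Seq (set_scratch 0 (RPlus (scratch 0)
              (RTimes (RGet 3 (NVar 3) (NVar 5)) (RGet 3 (NVar 4) (NVar 5)))))
            (set_scratch 1 (RPlus (scratch 1)
              (RTimes (RGet 3 (NVar 4) (NVar 5)) (RGet 3 (NVar 4) (NVar 5))))))) s'
      (\<lambda>s'. same {5} {4} s s' \<and> arr s' 4 0 0 = ip m (E i) (E j) \<and> arr s' 4 0 1 = ip m (E j) (E j))"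
    if "same {5} {4} s s'" "arr s' 4 0 0 = 0" "arr s' 4 0 1 = 0" for s'
    by (rule leads_For[where N = m and I = "\<lambda>k s'. same {5} {4} s s' \<and>
          arr s' 4 0 0 = ip k (E i) (E j) \<and> arr s' 4 0 1 = ip k (E j) (E j)"])
      (use assms that in \<open>auto intro!: leads_Seq leads_RSet simp: same_def ip_def\<close>)
  have update: "leads (n + m) (For 5 (NPlus (NVar 1) (NVar 0))
       (RSet 3 (NVar 3) (NVar 5) (RMinus (RGet 3 (NVar 3) (NVar 5))
         (RTimes (RDiv (scratch 0) (scratch 1)) (RGet 3 (NVar 4) (NVar 5)))))) s'
      (\<lambda>s'. same {5} {3, 4} s s' \<and> arr s' 3 = E(i :=
    (\<lambda>k. if k < m + n then E i k - ip m (E i) (E j) / ip m (E j) (E j) * E j k else E i k)))"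
    if "same {5} {4} s s'" "arr s' 4 0 0 = ip m (E i) (E j)" "arr s' 4 0 1 = ip m (E j) (E j)" for s'
    by (rule leads_mono[OF leads_fill_row[where N = "m + n" and E = E and i = i and
            f = "\<lambda>k. E i k - ip m (E i) (E j) / ip m (E j) (E j) * E j k"]])
      (use assms that in \<open>auto simp: same_def\<close>)
  show ?thesis
    unfolding orth_row_def
    by (rule leads_Seq, rule leads_RSet, rule leads_Seq, rule leads_RSet, rule leads_Seq,
        rule leads_mono[OF dots]) (use update in \<open>auto simp: same_def\<close>)
qed

lemma leads_init_row:
  assumes "cnt s 3 = i" "cnt s 0 = n" "cnt s 1 = m"
  shows "leads (n + m) init_row s (\<lambda>s'. same {5, 6} {3} s s' \<and>
    (if \<bar>arr s 2 i 0\<bar> < 1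
     then cnt s' 6 = i \<and> arr s' 3 = (arr s 3)(i :=
       (\<lambda>k. if k < m + n then arr s 0 i k else arr s 3 i k)(m + i := 1))
     else cnt s' 6 = cnt s 6 \<and> arr s' 3 = (arr s 3)(i :=
       (\<lambda>k. if k < m + n then 0 else arr s 3 i k))))"
proof -
  have row: "leads (n + m) (For 5 (NPlus (NVar 1) (NVar 0)) (RSet 3 (NVar 3) (NVar 5) r)) s
      (\<lambda>s'. same {5} {3} s s' \<and> arr s' 3 = (arr s 3)(i := (\<lambda>k. if k < m + n then f k else arr s 3 i k)))"
    if "\<And>k s'. same {5} {3} s s' \<Longrightarrow> cnt s' 5 = k \<Longrightarrow> rval r s' = f k" for r f
    using leads_fill_row[where N = "m + n" and E = "arr s 3" and i = i and K = "n + m"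
        and f = f and r = r and s = s] that assms
    by simp
  show ?thesis
    unfolding init_row_def
  proof (rule leads_Cond)
    assume "bval (BAnd (RLess (RConst (- 1)) pos_exp) (RLess pos_exp (RConst 1))) s"
    then have x: "\<bar>arr s 2 i 0\<bar> < 1" using assms by auto
    show "leads (n + m) (Seq (For 5 (NPlus (NVar 1) (NVar 0)) (RSet 3 (NVar 3) (NVar 5) (RGet 0 (NVar 3) (NVar 5))))
         (Seq (RSet 3 (NVar 3) (NPlus (NVar 1) (NVar 3)) (RConst 1)) (NSet 6 (NVar 3)))) s
      (\<lambda>s'. same {5, 6} {3} s s' \<and>
    (if \<bar>arr s 2 i 0\<bar> < 1
     then cnt s' 6 = i \<and> arr s' 3 = (arr s 3)(i :=
       (\<lambda>k. if k < m + n then arr s 0 i k else arr s 3 i k)(m + i := 1))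
     else cnt s' 6 = cnt s 6 \<and> arr s' 3 = (arr s 3)(i :=
       (\<lambda>k. if k < m + n then 0 else arr s 3 i k))))"
      by (rule leads_Seq, rule leads_mono[OF row[where f = "arr s 0 i"]])
        (use assms x in \<open>auto intro!: leads_Seq leads_RSet leads_NSet simp: same_def\<close>)
  next
    assume "\<not> bval (BAnd (RLess (RConst (- 1)) pos_exp) (RLess pos_exp (RConst 1))) s"
    then have x: "\<not> \<bar>arr s 2 i 0\<bar> < 1" using assms by auto
    show "leads (n + m) (For 5 (NPlus (NVar 1) (NVar 0)) (RSet 3 (NVar 3) (NVar 5) (RConst 0))) s
      (\<lambda>s'. same {5, 6} {3} s s' \<and>
    (if \<bar>arr s 2 i 0\<bar> < 1
     then cnt s' 6 = i \<and> arr s' 3 = (arr s 3)(i :=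
       (\<lambda>k. if k < m + n then arr s 0 i k else arr s 3 i k)(m + i := 1))
     else cnt s' 6 = cnt s 6 \<and> arr s' 3 = (arr s 3)(i :=
       (\<lambda>k. if k < m + n then 0 else arr s 3 i k))))"
      by (rule leads_mono[OF row[where f = "\<lambda>_. 0"]])
        (use x in \<open>auto simp: same_def\<close>)
  qed
qed

locale gs_rows =
  fixes n m :: nat and v :: "nat \<Rightarrow> nat \<Rightarrow> real" and A :: "nat set"
begin

text \<open>The invariant of row \<open>i\<close> once it is orthogonalized against the rows below
  \<open>j\<close>. The last conjunct is a dual form of \<open>E i - v i\<close> lying in the span
  of these rows: vectors orthogonal to them cannot tell \<open>E i\<close> from
  \<open>v i\<close>.\<close>

definition row_ok :: "(nat \<Rightarrow> nat \<Rightarrow> real) \<Rightarrow> nat \<Rightarrow> nat \<Rightarrow> bool" where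
  "row_ok E i j \<longleftrightarrow>
     (\<forall>k<m. E i k = comb n v (\<lambda>l. E i (m + l)) k) \<and>
     (\<forall>l<n. E i (m + l) \<noteq> 0 \<longrightarrow> l \<le> i \<and> l \<in> A) \<and>
     (i \<in> A \<longrightarrow> E i (m + i) = 1) \<and>
     (i \<notin> A \<longrightarrow> (\<forall>k<m + n. E i k = 0)) \<and>
     (\<forall>b<j. ip m (E i) (E b) = 0) \<and>
     (i \<in> A \<longrightarrow> (\<forall>y. (\<forall>b<j. ip m y (E b) = 0) \<longrightarrow> ip m y (E i) = ip m y (v i)))"

lemma row_okI:
  assumes "\<And>k. k < m \<Longrightarrow> E i k = comb n v (\<lambda>l. E i (m + l)) k"
    and "\<And>l. l < n \<Longrightarrow> E i (m + l) \<noteq> 0 \<Longrightarrow> l \<le> i \<and> l \<in> A"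
    and "i \<in> A \<Longrightarrow> E i (m + i) = 1"
    and "\<And>k. i \<notin> A \<Longrightarrow> k < m + n \<Longrightarrow> E i k = 0"
    and "\<And>b. b < j \<Longrightarrow> ip m (E i) (E b) = 0"
    and "\<And>y. i \<in> A \<Longrightarrow> \<forall>b<j. ip m y (E b) = 0 \<Longrightarrow> ip m y (E i) = ip m y (v i)"
  shows "row_ok E i j"
  unfolding row_ok_def
  by (intro conjI allI impI) ((rule assms; assumption) | (use assms(2) in blast))+

lemma row_okD:
  assumes "row_ok E i j"
  shows "k < m \<Longrightarrow> E i k = comb n v (\<lambda>l. E i (m + l)) k"
    and "l < n \<Longrightarrow> E i (m + l) \<noteq> 0 \<Longrightarrow> l \<le> i \<and> l \<in> A"
    and "i \<in> A \<Longrightarrow> E i (m + i) = 1"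
    and "i \<notin> A \<Longrightarrow> k < m + n \<Longrightarrow> E i k = 0"
    and "b < j \<Longrightarrow> ip m (E i) (E b) = 0"
    and "i \<in> A \<Longrightarrow> \<forall>b<j. ip m y (E b) = 0 \<Longrightarrow> ip m y (E i) = ip m y (v i)"
  using assms unfolding row_ok_def by meson+

lemma row_ok_upd:
  assumes "i < a" "j \<le> i"
  shows "row_ok (E(a := f)) i j \<longleftrightarrow> row_ok E i j"
proof -
  have "(E(a := f)) b = E b" if "b < j" for b using assms that by simp
  moreover have "(E(a := f)) i = E i" using assms by simp
  ultimately show ?thesis by (simp only: row_ok_def cong: imp_cong)
qed

lemma row_ok_frozen:
  assumes "i \<notin> A" "\<And>k. k < m + n \<Longrightarrow> E i k = 0"
  shows "row_ok E i 0"
  using assms by (auto simp: row_ok_def comb_def)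

lemma row_ok_alive:
  assumes "i \<in> A" "i < n" "\<And>k. k < m \<Longrightarrow> E i k = v i k"
    "\<And>l. l < n \<Longrightarrow> E i (m + l) = (if l = i then 1 else 0)"
  shows "row_ok E i 0"
proof -
  have "comb n v (\<lambda>l. E i (m + l)) k = v i k" for k
  proof -
    have "comb n v (\<lambda>l. E i (m + l)) k = (\<Sum>l<n. if l = i then v i k else 0)"
      unfolding comb_def using assms(4) by (intro sum.cong) auto
    then show ?thesis using \<open>i < n\<close> by simp
  qed
  moreover have "ip m y (E i) = ip m y (v i)" for y
    using assms(3) by (intro ip_cong) auto
  ultimately show ?thesis
    using assms by (intro row_okI) (auto split: if_splits)
qed

definition orthogonalize :: "(nat \<Rightarrow> nat \<Rightarrow> real) \<Rightarrow> nat \<Rightarrow> nat \<Rightarrow> nat \<Rightarrow> real" where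
  "orthogonalize E i j = (\<lambda>k. if k < m + n
     then E i k - ip m (E i) (E j) / ip m (E j) (E j) * E j k else E i k)"

text \<open>Row \<open>j\<close> is already orthogonal to its predecessors, so subtracting a
  multiple of it preserves the orthogonality reached so far. Its coefficients are supported on
  indices up to \<open>j < i\<close>, so the coefficient 1 at \<open>i\<close> survives.\<close>

lemma row_ok_step:
  assumes below: "\<And>a. a < i \<Longrightarrow> row_ok E a a" and i: "row_ok E i j" and "j < i" "i < n"
  shows "row_ok (E(i := orthogonalize E i j)) i (Suc j)"
proof -
  define r where "r = ip m (E i) (E j) / ip m (E j) (E j)"
  define F where "F = orthogonalize E i j"
  have F: "F k = E i k - r * E j k" if "k < m + n" for k
    using that by (simp add: F_def orthogonalize_def r_def)
  have j: "row_ok E j j" using below \<open>j < i\<close> .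
  have orth: "ip m (E j) (E b) = 0" if "b < j" for b
    using row_okD(5)[OF j that] .
  have ipF: "ip m F y = ip m (E i) y - r * ip m (E j) y"
    "ip m y F = ip m y (E i) - r * ip m y (E j)" for y
  proof -
    have "ip m F y = ip m (\<lambda>k. E i k - r * E j k) y"
      by (rule ip_cong) (auto simp: F)
    then show "ip m F y = ip m (E i) y - r * ip m (E j) y" by (simp add: ip_linear)
    then show "ip m y F = ip m y (E i) - r * ip m y (E j)"
      by (simp add: ip_commute[of m y])
  qed
  \<comment> \<open>A null row \<open>E j\<close> is orthogonal to everything, so dividing by its
    zero length does no harm.\<close>
  have zero: "ip m F (E j) = 0"
  proof (cases "ip m (E j) (E j) = 0")
    case True
    then show ?thesis using ip_self_zero[OF True] by (simp add: ipF)
  next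
    case False
    then show ?thesis by (simp add: ipF r_def)
  qed
  have "F k = comb n v (\<lambda>l. F (m + l)) k" if "k < m" for k
  proof -
    have "comb n v (\<lambda>l. F (m + l)) k = comb n v (\<lambda>l. E i (m + l) - r * E j (m + l)) k"
      unfolding comb_def by (intro sum.cong) (auto simp: F)
    also have "\<dots> = E i k - r * E j k"
      using row_okD(1)[OF i that] row_okD(1)[OF j that] by (simp add: comb_linear)
    finally show ?thesis using that by (simp add: F)
  qed
  moreover have "l \<le> i \<and> l \<in> A" if "l < n" "F (m + l) \<noteq> 0" for l
  proof -
    have "E i (m + l) \<noteq> 0 \<or> E j (m + l) \<noteq> 0" using that by (auto simp: F)
    then show ?thesis
      using row_okD(2)[OF i that(1)] row_okD(2)[OF j that(1)] \<open>j < i\<close> by auto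
  qed
  moreover have "F (m + i) = 1" if "i \<in> A"
  proof -
    have "E j (m + i) = 0" using row_okD(2)[OF j \<open>i < n\<close>] \<open>j < i\<close> by auto
    then show ?thesis using row_okD(3)[OF i that] \<open>i < n\<close> by (simp add: F)
  qed
  moreover have "F k = 0" if "i \<notin> A" "k < m + n" for k
  proof -
    have "ip m (E i) (E j) = 0"
      using row_okD(4)[OF i that(1)] by (auto simp: ip_def intro!: sum.neutral)
    then show ?thesis using row_okD(4)[OF i that] that(2) by (simp add: F r_def)
  qed
  moreover have "ip m F (E b) = 0" if "b < Suc j" for b
  proof (cases "b = j")
    case True
    then show ?thesis using zero by simp
  next
    case False
    then have "b < j" using that by simp
    then show ?thesis using row_okD(5)[OF i] orth by (simp add: ipF)
  qed
  moreover have "ip m y F = ip m y (v i)" if "i \<in> A" "\<forall>b<Suc j. ip m y (E b) = 0" for y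
    using row_okD(6)[OF i that(1)] that(2) by (simp add: ipF)
  ultimately have "row_ok (E(i := F)) i (Suc j)"
    using \<open>j < i\<close> by (intro row_okI) auto
  then show ?thesis by (simp add: F_def)
qed

text \<open>Every other alive \<open>j\<close> lies below the maximum \<open>p\<close>. Row
  \<open>p\<close> is orthogonal to all rows up to \<open>j\<close>, hence does not distinguish
  \<open>E j\<close> from \<open>v j\<close> and is orthogonal to \<open>v j\<close> as
  well.\<close>

lemma walk_dir_row:
  assumes rows: "\<And>a. a < n \<Longrightarrow> row_ok E a a" and p: "p \<in> A" "\<And>a. a \<in> A \<Longrightarrow> a \<le> p" and "p < n"
  shows "walk_dir n m v A p (\<lambda>l. if l < n then E p (m + l) else 0)"
proof -
  define u where "u = (\<lambda>l. if l < n then E p (m + l) else 0)"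
  have rp: "row_ok E p p" using rows \<open>p < n\<close> .
  have "comb n v u k = E p k" if "k < m" for k
  proof -
    have "comb n v u k = comb n v (\<lambda>l. E p (m + l)) k" by (simp add: comb_def u_def)
    then show ?thesis using row_okD(1)[OF rp that] by simp
  qed
  then have ipu: "ip m (comb n v u) y = ip m (E p) y" for y by (intro ip_cong) auto
  have "ip m (E p) (v j) = 0" if "j \<in> A - {p}" for j
  proof -
    have "j < p" using p(2)[of j] that by auto
    then have o: "ip m (E p) (E b) = 0" if "b \<le> j" for b
      using row_okD(5)[OF rp] that by simp
    have "row_ok E j j" using rows[of j] \<open>j < p\<close> \<open>p < n\<close> by simp
    then have "ip m (E p) (E j) = ip m (E p) (v j)"
      using o that by (intro row_okD(6)) auto
    then show ?thesis using o[of j] by simp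
  qed
  moreover have "supp_in A u" "u p = 1"
    using row_okD(2,3)[OF rp] p(1) \<open>p < n\<close> by (auto simp: supp_in_def u_def)
  ultimately show ?thesis by (auto simp: walk_dir_def ipu simp flip: u_def)
qed

end

context gs_rows
begin

lemma leads_orth_loop:
  assumes s: "cnt s 0 = n" "cnt s 1 = m" "cnt s 3 = i" "i < n"
    and rows: "\<And>a. a < i \<Longrightarrow> row_ok (arr s 3) a a" "row_ok (arr s 3) i 0"
  shows "leads (n + m) (For 4 (NVar 3) orth_row) s
    (\<lambda>s'. same {4, 5} {3, 4} s s' \<and> (\<forall>a<Suc i. row_ok (arr s' 3) a a))"
proof (rule leads_For[where N = i and I = "\<lambda>j s'. same {4, 5} {3, 4} s s' \<and>
      (\<forall>a<i. row_ok (arr s' 3) a a) \<and> row_ok (arr s' 3) i j"])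
  fix j s' assume j: "j < i" "cnt s' 4 = j"
    and s': "same {4, 5} {3, 4} s s' \<and> (\<forall>a<i. row_ok (arr s' 3) a a) \<and> row_ok (arr s' 3) i j"
  define E where "E = arr s' 3"
  have "leads (n + m) orth_row s' (\<lambda>s''. same {5} {3, 4} s' s'' \<and>
      arr s'' 3 = E(i := orthogonalize E i j))"
    unfolding orthogonalize_def using j s' s
    by (intro leads_orth_row) (auto simp: E_def same_def)
  moreover have "row_ok (E(i := orthogonalize E i j)) i (Suc j)"
    using s' j \<open>i < n\<close> by (intro row_ok_step) (auto simp: E_def)
  moreover have "row_ok (E(i := orthogonalize E i j)) a a" if "a < i" for a
    using s' that by (simp add: row_ok_upd E_def)
  ultimately show "leads (n + m) orth_row s' (\<lambda>s''. cnt s'' 4 = j \<and>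
      same {4, 5} {3, 4} s (set_cnt 4 (Suc j) s'') \<and>
      (\<forall>a<i. row_ok (arr (set_cnt 4 (Suc j) s'') 3) a a) \<and>
      row_ok (arr (set_cnt 4 (Suc j) s'') 3) i (Suc j))"
    by (elim leads_mono) (use j s' in \<open>auto simp: same_def\<close>)
qed (use s rows in \<open>auto simp: same_def less_Suc_eq\<close>)

lemma leads_gram_schmidt:
  assumes s: "cnt s 0 = n" "cnt s 1 = m" "cnt s 6 = 0"
    and V: "\<And>i k. i < n \<Longrightarrow> arr s 0 i k = (if k < m then v i k else 0)"
    and A: "A = alive n (\<lambda>i. arr s 2 i 0)"
  shows "leads (n + m) gram_schmidt s (\<lambda>s'. same {3, 4, 5, 6} {3, 4} s s' \<and>
    (\<forall>a<n. row_ok (arr s' 3) a a) \<and> (\<forall>a\<in>A. a \<le> cnt s' 6) \<and> (cnt s' 6 \<in> A \<or> cnt s' 6 = 0))"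
  unfolding gram_schmidt_def
proof (rule leads_For[where N = n and I = "\<lambda>i s'. same {3, 4, 5, 6} {3, 4} s s' \<and>
      (\<forall>a<i. row_ok (arr s' 3) a a) \<and> (\<forall>a\<in>A. a < i \<longrightarrow> a \<le> cnt s' 6) \<and>
      (cnt s' 6 \<in> A \<or> cnt s' 6 = 0)"])
  fix i s' assume i: "i < n" "cnt s' 3 = i"
    and s': "same {3, 4, 5, 6} {3, 4} s s' \<and>
      (\<forall>a<i. row_ok (arr s' 3) a a) \<and> (\<forall>a\<in>A. a < i \<longrightarrow> a \<le> cnt s' 6) \<and>
      (cnt s' 6 \<in> A \<or> cnt s' 6 = 0)"
  have iA: "\<bar>arr s' 2 i 0\<bar> < 1 \<longleftrightarrow> i \<in> A"
    using s' i by (simp add: A alive_def same_def)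
  have "leads (n + m) init_row s' (\<lambda>s''. same {5, 6} {3} s' s'' \<and>
      (\<forall>a<i. row_ok (arr s'' 3) a a) \<and> row_ok (arr s'' 3) i 0 \<and>
      cnt s'' 6 = (if i \<in> A then i else cnt s' 6))"
  proof (rule leads_mono[OF leads_init_row[of s' i n m]], goal_cases)
    case (4 s'')
    have "row_ok (arr s'' 3) i 0"
    proof (cases "i \<in> A")
      case True
      then have "arr s'' 3 i = (\<lambda>k. if k < m + n then arr s' 0 i k else arr s' 3 i k)(m + i := 1)"
        using 4 iA by simp
      moreover have "arr s' 0 i k = (if k < m then v i k else 0)" for k
        using V[OF i(1)] s' by (simp add: same_def)
      ultimately show ?thesis using True i(1) by (intro row_ok_alive) simp_all
    next
      case False
      then have "arr s'' 3 i = (\<lambda>k. if k < m + n then 0 else arr s' 3 i k)"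
        using 4 iA by simp
      then show ?thesis using False by (intro row_ok_frozen) simp_all
    qed
    moreover have "row_ok (arr s'' 3) a a" if "a < i" for a
    proof -
      have "row_ok (arr s' 3) a a" using s' that by simp
      with 4 iA that show ?thesis by (cases "i \<in> A") (simp_all add: row_ok_upd)
    qed
    ultimately show ?case using 4 iA by simp
  qed (use s s' i in \<open>auto simp: same_def\<close>)
  then show "leads (n + m) (Seq init_row (For 4 (NVar 3) orth_row)) s' (\<lambda>s''. cnt s'' 3 = i \<and>
      same {3, 4, 5, 6} {3, 4} s (set_cnt 3 (Suc i) s'') \<and>
      (\<forall>a<Suc i. row_ok (arr (set_cnt 3 (Suc i) s'') 3) a a) \<and>
      (\<forall>a\<in>A. a < Suc i \<longrightarrow> a \<le> cnt (set_cnt 3 (Suc i) s'') 6) \<and>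
      (cnt (set_cnt 3 (Suc i) s'') 6 \<in> A \<or> cnt (set_cnt 3 (Suc i) s'') 6 = 0))"
  proof (intro leads_Seq, elim leads_mono)
    fix s1
    assume s1: "same {5, 6} {3} s' s1 \<and> (\<forall>a<i. row_ok (arr s1 3) a a) \<and> row_ok (arr s1 3) i 0 \<and>
      cnt s1 6 = (if i \<in> A then i else cnt s' 6)"
    have "leads (n + m) (For 4 (NVar 3) orth_row) s1
        (\<lambda>s'. same {4, 5} {3, 4} s1 s' \<and> (\<forall>a<Suc i. row_ok (arr s' 3) a a))"
      using s s' s1 i by (intro leads_orth_loop) (auto simp: same_def)
    then show "leads (n + m) (For 4 (NVar 3) orth_row) s1 (\<lambda>s''. cnt s'' 3 = i \<and>
      same {3, 4, 5, 6} {3, 4} s (set_cnt 3 (Suc i) s'') \<and>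
      (\<forall>a<Suc i. row_ok (arr (set_cnt 3 (Suc i) s'') 3) a a) \<and>
      (\<forall>a\<in>A. a < Suc i \<longrightarrow> a \<le> cnt (set_cnt 3 (Suc i) s'') 6) \<and>
      (cnt (set_cnt 3 (Suc i) s'') 6 \<in> A \<or> cnt (set_cnt 3 (Suc i) s'') 6 = 0))"
    proof (rule leads_mono)
      fix s2 assume s2: "same {4, 5} {3, 4} s1 s2 \<and> (\<forall>a<Suc i. row_ok (arr s2 3) a a)"
      have "cnt s2 6 = (if i \<in> A then i else cnt s' 6)" using s1 s2 by (simp add: same_def)
      moreover have "cnt s2 3 = i" "same {3, 4, 5, 6} {3, 4} s (set_cnt 3 (Suc i) s2)"
        using s' s1 s2 i by (auto simp: same_def)
      ultimately show "cnt s2 3 = i \<and>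
        same {3, 4, 5, 6} {3, 4} s (set_cnt 3 (Suc i) s2) \<and>
        (\<forall>a<Suc i. row_ok (arr (set_cnt 3 (Suc i) s2) 3) a a) \<and>
        (\<forall>a\<in>A. a < Suc i \<longrightarrow> a \<le> cnt (set_cnt 3 (Suc i) s2) 6) \<and>
        (cnt (set_cnt 3 (Suc i) s2) 6 \<in> A \<or> cnt (set_cnt 3 (Suc i) s2) 6 = 0)"
        using s' s2 by (auto simp: less_Suc_eq)
    qed
  qed
next
  fix s' assume "cnt s' 3 = n" and s': "same {3, 4, 5, 6} {3, 4} s s' \<and>
      (\<forall>a<n. row_ok (arr s' 3) a a) \<and> (\<forall>a\<in>A. a < n \<longrightarrow> a \<le> cnt s' 6) \<and>
      (cnt s' 6 \<in> A \<or> cnt s' 6 = 0)"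
  then show "same {3, 4, 5, 6} {3, 4} s s' \<and>
    (\<forall>a<n. row_ok (arr s' 3) a a) \<and> (\<forall>a\<in>A. a \<le> cnt s' 6) \<and> (cnt s' 6 \<in> A \<or> cnt s' 6 = 0)"
    by (auto simp: A alive_def)
qed (use s in \<open>auto simp: same_def\<close>)

end

section \<open>Step lengths\<close>

lemma abs_shrink_le_one:
  fixes x u d d' :: real
  assumes "\<bar>x\<bar> \<le> 1" "\<bar>x + d * u\<bar> \<le> 1" "0 < d'" "d' \<le> d"
  shows "\<bar>x + d' * u\<bar> \<le> 1"
proof (cases "0 \<le> u")
  case True
  then have "0 \<le> d' * u" "d' * u \<le> d * u"
    using assms(3,4) by (simp_all add: mult_right_mono)
  with assms(1,2) show ?thesis unfolding abs_le_iff by linarith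
next
  case False
  then have "d' * u \<le> 0" "d * u \<le> d' * u"
    using assms(3,4) by (simp_all add: mult_right_mono_neg mult_nonneg_nonpos)
  with assms(1,2) show ?thesis unfolding abs_le_iff by linarith
qed

text \<open>Coordinates below \<open>k\<close> have been scanned. The last disjunction says that
  \<open>d\<close> is still the initial value or that the step freezes an alive coordinate.\<close>

definition reach_inv :: "nat \<Rightarrow> (nat \<Rightarrow> real) \<Rightarrow> (nat \<Rightarrow> real) \<Rightarrow> nat \<Rightarrow> real \<Rightarrow> bool" where
  "reach_inv n x u k d \<longleftrightarrow> 0 < d \<and> (\<forall>i<k. \<bar>x i + d * u i\<bar> \<le> 1) \<and>
     (d = 2 \<or> (\<exists>i<n. \<bar>x i\<bar> < 1 \<and> \<bar>x i + d * u i\<bar> = 1))"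

text \<open>By convexity a shorter step keeps the scanned coordinates in the cube; coordinate
  \<open>k\<close> becomes the one that freezes.\<close>

lemma reach_inv_tighten:
  assumes inv: "reach_inv n x u k d" and x: "\<And>i. i < n \<Longrightarrow> \<bar>x i\<bar> \<le> 1" and k: "k < n" "\<bar>x k\<bar> < 1"
    and d': "0 < d'" "d' < d" "\<bar>x k + d' * u k\<bar> = 1"
  shows "reach_inv n x u (Suc k) d'"
proof -
  have "\<bar>x i + d' * u i\<bar> \<le> 1" if "i < Suc k" for i
  proof (cases "i = k")
    case True
    then show ?thesis using eq_refl[OF d'(3)] by simp
  next
    case False
    then have "i < k" "i < n" using that k(1) by auto
    then have "\<bar>x i + d * u i\<bar> \<le> 1" using inv unfolding reach_inv_def by blast
    then show ?thesis using abs_shrink_le_one[of "x i" d "u i" d'] x[OF \<open>i < n\<close>] d'(1,2) by simp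
  qed
  moreover have "\<exists>i<n. \<bar>x i\<bar> < 1 \<and> \<bar>x i + d' * u i\<bar> = 1" using k d'(3) by blast
  ultimately show ?thesis using d'(1) unfolding reach_inv_def by blast
qed

lemma reach_inv_keep:
  assumes "reach_inv n x u k d" "\<bar>x k + d * u k\<bar> \<le> 1"
  shows "reach_inv n x u (Suc k) d"
  using assms unfolding reach_inv_def less_Suc_eq by blast

text \<open>Stated for any expression \<open>r\<close> with values \<open>u i\<close>, to serve both
  the direction and its negative. By \<open>supp\<close> the quotients are formed only at alive
  coordinates, hence positive; the other scratch cells are preserved so that the second call keeps
  the first result.\<close>

lemma leads_reach:
  assumes n: "cnt s 0 = n" and x: "\<And>i. arr s 2 i 0 = x i" "\<And>i. i < n \<Longrightarrow> \<bar>x i\<bar> \<le> 1"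
    and supp: "\<And>i. i < n \<Longrightarrow> u i \<noteq> 0 \<Longrightarrow> \<bar>x i\<bar> < 1"
    and r: "\<And>s' i. same {3} {4} s s' \<Longrightarrow> cnt s' 3 = i \<Longrightarrow> i < n \<Longrightarrow> rval r s' = u i"
  shows "leads (n + m) (reach q r) s (\<lambda>s'. same {3} {4} s s' \<and>
    (\<forall>q'. q' \<noteq> q \<longrightarrow> arr s' 4 0 q' = arr s 4 0 q') \<and> reach_inv n x u n (arr s' 4 0 q))"
proof -
  define I where "I k s' \<longleftrightarrow> same {3} {4} s s' \<and>
    (\<forall>q'. q' \<noteq> q \<longrightarrow> arr s' 4 0 q' = arr s 4 0 q') \<and> reach_inv n x u k (arr s' 4 0 q)" for k s'
  show ?thesis
    unfolding reach_def
  proof (rule leads_Seq, rule leads_RSet, rule leads_For[where N = n and I = I])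
    show "I 0 (set_cnt 3 0 (set_arr 4 (nval (NConst 0) s) (nval (NConst q) s) (rval (RConst 2) s) s))"
      by (simp add: I_def same_def reach_inv_def)
  next
    fix k s' assume k: "k < n" "cnt s' 3 = k" and I: "I k s'"
    define d where "d = arr s' 4 0 q"
    have ru: "rval r s' = u k" using I k by (intro r) (auto simp: I_def)
    have xk: "arr s' 2 k 0 = x k" using I x(1) by (simp add: I_def same_def)
    have inv: "reach_inv n x u k d" using I by (simp add: I_def d_def)
    then have "0 < d" by (simp add: reach_inv_def)
    have set: "leads (n + m) (set_scratch q e) s'
        (\<lambda>s''. cnt s'' 3 = k \<and> I (Suc k) (set_cnt 3 (Suc k) s''))"
      if "reach_inv n x u (Suc k) (rval e s')" for e
      using that I k by (intro leads_RSet) (auto simp: I_def same_def)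
    have skip: "leads (n + m) Skip s' (\<lambda>s''. cnt s'' 3 = k \<and> I (Suc k) (set_cnt 3 (Suc k) s''))"
      if "\<bar>x k + d * u k\<bar> \<le> 1"
      using reach_inv_keep[OF inv that] I k by (intro leads_Skip) (auto simp: I_def same_def d_def)
    have pos: "\<bar>x k\<bar> < 1" if "u k \<noteq> 0" using supp k that by simp
    have up: "reach_inv n x u (Suc k) ((1 - x k) / u k)" if "0 < u k" "(1 - x k) / u k < d"
    proof (rule reach_inv_tighten[OF inv x(2) k(1)])
      show "\<bar>x k\<bar> < 1" using pos that by simp
      then show "0 < (1 - x k) / u k" using that by (intro divide_pos_pos) auto
      show "\<bar>x k + (1 - x k) / u k * u k\<bar> = 1" using that by simp
    qed (use that in auto)
    have down: "reach_inv n x u (Suc k) ((- 1 - x k) / u k)" if "u k < 0" "(- 1 - x k) / u k < d"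
    proof (rule reach_inv_tighten[OF inv x(2) k(1)])
      show "\<bar>x k\<bar> < 1" using pos that by simp
      then show "0 < (- 1 - x k) / u k" using that by (intro divide_neg_neg) auto
      show "\<bar>x k + (- 1 - x k) / u k * u k\<bar> = 1" using that by simp
    qed (use that in auto)
    have up_skip: "\<bar>x k + d * u k\<bar> \<le> 1" if "0 < u k" "\<not> (1 - x k) / u k < d"
    proof -
      have "d * u k \<le> 1 - x k" "0 \<le> d * u k"
        using that \<open>0 < d\<close> by (simp_all add: not_less pos_le_divide_eq)
      then show ?thesis using x(2)[OF k(1)] by linarith
    qed
    have down_skip: "\<bar>x k + d * u k\<bar> \<le> 1" if "u k < 0" "\<not> (- 1 - x k) / u k < d"
    proof -
      have "- 1 - x k \<le> d * u k" "d * u k \<le> 0"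
        using that \<open>0 < d\<close> by (simp_all add: not_less neg_le_divide_eq mult_nonneg_nonpos)
      then show ?thesis using x(2)[OF k(1)] by linarith
    qed
    show "leads (n + m)
         (Cond (RLess (RConst 0) r)
           (Cond (RLess (RDiv (RMinus (RConst 1) pos_exp) r) (scratch q))
             (set_scratch q (RDiv (RMinus (RConst 1) pos_exp) r)) Skip)
           (Cond (RLess r (RConst 0))
             (Cond (RLess (RDiv (RMinus (RConst (-1)) pos_exp) r) (scratch q))
               (set_scratch q (RDiv (RMinus (RConst (-1)) pos_exp) r)) Skip)
             Skip)) s'
         (\<lambda>s''. cnt s'' 3 = k \<and> I (Suc k) (set_cnt 3 (Suc k) s''))"
    proof (intro leads_Cond, goal_cases)
      case 1
      then show ?case using k xk ru up by (intro set) (simp add: d_def)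
    next
      case 2
      then show ?case using k xk ru up_skip by (intro skip) (simp add: d_def)
    next
      case 3
      then show ?case using k xk ru down by (intro set) (simp add: d_def)
    next
      case 4
      then show ?case using k xk ru down_skip by (intro skip) (simp add: d_def)
    next
      case 5
      then have "u k = 0" using ru by simp
      then show ?case using x(2)[OF k(1)] by (intro skip) simp
    qed
  next
    show "nval (NVar 0) s' = n" if "I k s'" for k s' using that n by (simp add: I_def same_def)
  next
    fix s' assume "I n s'"
    then show "same {3} {4} s s' \<and> (\<forall>q'. q' \<noteq> q \<longrightarrow> arr s' 4 0 q' = arr s 4 0 q') \<and>
        reach_inv n x u n (arr s' 4 0 q)"
      by (simp add: I_def)
  qed simp
qed

text \<open>Extends \<open>walk_dir\<close> to points with nothing alive, where the zero direction
  makes the round idle.\<close>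

definition dir_ok :: "nat \<Rightarrow> nat \<Rightarrow> (nat \<Rightarrow> nat \<Rightarrow> real) \<Rightarrow> (nat \<Rightarrow> real) \<Rightarrow> (nat \<Rightarrow> real) \<Rightarrow> bool" where
  "dir_ok n m v x u \<longleftrightarrow> (\<forall>i\<ge>n. u i = 0) \<and>
     (if alive n x = {} then u = (\<lambda>_. 0) else walk_dir n m v (alive n x) (Max (alive n x)) u)"

lemma dir_ok_supp: "dir_ok n m v x u \<Longrightarrow> u i \<noteq> 0 \<Longrightarrow> \<bar>x i\<bar> < 1"
  by (auto simp: dir_ok_def walk_dir_def supp_in_def alive_def split: if_splits)

lemma dir_ok_rows:
  assumes rows: "\<And>a. a < n \<Longrightarrow> gs_rows.row_ok n m v (alive n x) E a a"
    and p: "\<And>a. a \<in> alive n x \<Longrightarrow> a \<le> p" "p \<in> alive n x \<or> p = 0"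
  shows "dir_ok n m v x (\<lambda>l. if l < n then E p (m + l) else 0)"
proof (cases "alive n x = {}")
  case True
  have "E p (m + l) = 0" if "l < n" for l
  proof -
    have "gs_rows.row_ok n m v (alive n x) E 0 0" using rows[of 0] that by simp
    then have "E 0 (m + l) = 0" by (rule gs_rows.row_okD(4)) (use True that in auto)
    then show ?thesis using p(2) True by simp
  qed
  then show ?thesis using True by (auto simp: dir_ok_def)
next
  case False
  then have pA: "p \<in> alive n x" using p by fastforce
  then have "Max (alive n x) = p" using p(1) finite_alive by (intro Max_eqI) auto
  moreover have "walk_dir n m v (alive n x) p (\<lambda>l. if l < n then E p (m + l) else 0)"
    using rows p(1) pA by (intro gs_rows.walk_dir_row) (auto simp: alive_def)
  ultimately show ?thesis using False by (simp add: dir_ok_def)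
qed

section \<open>One round of the walk\<close>

lemma leads_prepare:
  assumes s: "cnt s 0 = n" "cnt s 1 = m"
    and V: "\<And>i k. i < n \<Longrightarrow> arr s 0 i k = (if k < m then v i k else 0)"
    and x: "\<And>i. arr s 2 i 0 = x i" "\<And>i. i < n \<Longrightarrow> \<bar>x i\<bar> \<le> 1"
  shows "leads (n + m) prepare s (\<lambda>s'. same {3, 4, 5, 6} {3, 4} s s' \<and>
    (\<exists>u. dir_ok n m v x u \<and> (\<forall>i<n. arr s' 3 (cnt s' 6) (m + i) = u i) \<and>
      reach_inv n x u n (arr s' 4 0 2) \<and> reach_inv n x (\<lambda>i. - u i) n (arr s' 4 0 3)))"
proof -
  have A: "alive n x = alive n (\<lambda>i. arr s 2 i 0)" using x(1) by simp
  have gs: "leads (n + m) gram_schmidt (set_cnt 6 0 s) (\<lambda>s'. same {3, 4, 5, 6} {3, 4} s s' \<and>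
    (\<forall>a<n. gs_rows.row_ok n m v (alive n x) (arr s' 3) a a) \<and>
    (\<forall>a\<in>alive n x. a \<le> cnt s' 6) \<and> (cnt s' 6 \<in> alive n x \<or> cnt s' 6 = 0))"
    by (rule leads_mono[OF gs_rows.leads_gram_schmidt[where v = v and A = "alive n x"]])
      (use s V A in \<open>auto simp: same_def\<close>)
  have steps: "leads (n + m) (Seq (reach 2 dir_exp) (reach 3 (RMinus (RConst 0) dir_exp))) s1
      (\<lambda>s'. same {3, 4, 5, 6} {3, 4} s s' \<and>
    (\<exists>u. dir_ok n m v x u \<and> (\<forall>i<n. arr s' 3 (cnt s' 6) (m + i) = u i) \<and>
      reach_inv n x u n (arr s' 4 0 2) \<and> reach_inv n x (\<lambda>i. - u i) n (arr s' 4 0 3)))"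
    if s1: "same {3, 4, 5, 6} {3, 4} s s1"
      and rows: "\<forall>a<n. gs_rows.row_ok n m v (alive n x) (arr s1 3) a a"
      and p: "\<forall>a\<in>alive n x. a \<le> cnt s1 6" "cnt s1 6 \<in> alive n x \<or> cnt s1 6 = 0" for s1
  proof -
    define u where "u = (\<lambda>l. if l < n then arr s1 3 (cnt s1 6) (m + l) else 0)"
    have u: "dir_ok n m v x u"
      unfolding u_def using rows p by (intro dir_ok_rows) auto
    have c1: "cnt s1 0 = n" "cnt s1 1 = m" "\<And>i. arr s1 2 i 0 = x i"
      using s s1 x(1) by (auto simp: same_def)
    have r1: "leads (n + m) (reach 2 dir_exp) s1 (\<lambda>s'. same {3} {4} s1 s' \<and>
        (\<forall>q'. q' \<noteq> 2 \<longrightarrow> arr s' 4 0 q' = arr s1 4 0 q') \<and> reach_inv n x u n (arr s' 4 0 2))"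
      by (rule leads_reach[OF c1(1,3) x(2)])
        (use c1 dir_ok_supp[OF u] in \<open>auto simp: same_def u_def\<close>)
    show ?thesis
    proof (rule leads_Seq, rule leads_mono[OF r1])
      fix s2 assume s2: "same {3} {4} s1 s2 \<and>
        (\<forall>q'. q' \<noteq> 2 \<longrightarrow> arr s2 4 0 q' = arr s1 4 0 q') \<and> reach_inv n x u n (arr s2 4 0 2)"
      then have c2: "cnt s2 0 = n" "cnt s2 1 = m" "\<And>i. arr s2 2 i 0 = x i"
        "arr s2 3 = arr s1 3" "cnt s2 6 = cnt s1 6"
        using c1 by (auto simp: same_def)
      have "leads (n + m) (reach 3 (RMinus (RConst 0) dir_exp)) s2 (\<lambda>s'. same {3} {4} s2 s' \<and>
        (\<forall>q'. q' \<noteq> 3 \<longrightarrow> arr s' 4 0 q' = arr s2 4 0 q') \<and>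
        reach_inv n x (\<lambda>i. - u i) n (arr s' 4 0 3))"
        by (rule leads_reach[OF c2(1,3) x(2)])
          (use c2 dir_ok_supp[OF u] in \<open>auto simp: same_def u_def\<close>)
      then show "leads (n + m) (reach 3 (RMinus (RConst 0) dir_exp)) s2
          (\<lambda>s'. same {3, 4, 5, 6} {3, 4} s s' \<and>
        (\<exists>u. dir_ok n m v x u \<and> (\<forall>i<n. arr s' 3 (cnt s' 6) (m + i) = u i) \<and>
          reach_inv n x u n (arr s' 4 0 2) \<and> reach_inv n x (\<lambda>i. - u i) n (arr s' 4 0 3)))"
      proof (rule leads_mono)
        fix s3 assume s3: "same {3} {4} s2 s3 \<and>
          (\<forall>q'. q' \<noteq> 3 \<longrightarrow> arr s3 4 0 q' = arr s2 4 0 q') \<and>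
          reach_inv n x (\<lambda>i. - u i) n (arr s3 4 0 3)"
        have "same {3, 4, 5, 6} {3, 4} s s3" using s1 s2 s3 by (simp add: same_def)
        moreover have "arr s3 3 (cnt s3 6) (m + i) = u i" if "i < n" for i
          using s3 c2 that by (simp add: same_def u_def)
        moreover have "reach_inv n x u n (arr s3 4 0 2)" using s2 s3 by simp
        ultimately show "same {3, 4, 5, 6} {3, 4} s s3 \<and>
          (\<exists>u. dir_ok n m v x u \<and> (\<forall>i<n. arr s3 3 (cnt s3 6) (m + i) = u i) \<and>
            reach_inv n x u n (arr s3 4 0 2) \<and> reach_inv n x (\<lambda>i. - u i) n (arr s3 4 0 3))"
          using s3 u by blast
      qed
    qed
  qed
  show ?thesis
    unfolding prepare_def
    by (rule leads_Seq, rule leads_NSet, rule leads_Seq, unfold nval.simps, rule leads_mono[OF gs])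
      (use steps in blast)
qed

lemma leads_move:
  assumes s: "cnt s 0 = n" "cnt s 1 = m" "\<And>i. arr s 2 i 0 = x i"
    and u: "\<And>i. i < n \<Longrightarrow> arr s 3 (cnt s 6) (m + i) = u i" "\<And>i. i \<ge> n \<Longrightarrow> u i = 0"
    and \<delta>: "\<delta> = (if 0 < cnt s 7 then arr s 4 0 2 else - arr s 4 0 3)"
  shows "leads (n + m) move s (\<lambda>s'. same {3} {2, 4} s s' \<and> (\<forall>i. arr s' 2 i 0 = x i + \<delta> * u i))"
proof -
  have loop: "leads (n + m) (For 3 (NVar 0)
      (RSet 2 (NVar 3) (NConst 0) (RPlus pos_exp (RTimes (scratch 2) dir_exp)))) s1
      (\<lambda>s'. same {3} {2, 4} s s' \<and> (\<forall>i. arr s' 2 i 0 = x i + \<delta> * u i))"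
    if "same {} {4} s s1" "arr s1 4 0 2 = \<delta>" for s1
    by (rule leads_mono[OF leads_fill_col[where N = n and f = "\<lambda>i. x i + \<delta> * u i"]])
      (use that s u in \<open>auto simp: same_def\<close>)
  show ?thesis
    unfolding move_def
    by (rule leads_Seq, rule leads_Cond; (rule leads_Skip leads_RSet)?; rule loop)
      (use \<delta> in \<open>auto simp: same_def\<close>)
qed

text \<open>Preparation and move are deterministic on either side of a single coin flip, so the
  outcome is a distribution on two stores.\<close>

lemma exec_walk_round:
  assumes s: "cnt s 0 = n" "cnt s 1 = m"
    and V: "\<And>i k. i < n \<Longrightarrow> arr s 0 i k = (if k < m then v i k else 0)"
    and x: "\<And>i. arr s 2 i 0 = x i" "\<And>i. i < n \<Longrightarrow> \<bar>x i\<bar> \<le> 1"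
  obtains u d e s\<^sub>1 s\<^sub>2 where "dir_ok n m v x u" "reach_inv n x u n d"
    "reach_inv n x (\<lambda>i. - u i) n e"
    "same {3, 4, 5, 6, 7} {2, 3, 4} s s\<^sub>1" "\<And>i. arr s\<^sub>1 2 i 0 = x i + d * u i"
    "same {3, 4, 5, 6, 7} {2, 3, 4} s s\<^sub>2" "\<And>i. arr s\<^sub>2 2 i 0 = x i - e * u i"
    "exec walk_round s (poly (cost walk_round) (n + m))
      (map_pmf (\<lambda>b. if b then s\<^sub>1 else s\<^sub>2) (bernoulli_pmf (e / (d + e))))"
proof -
  have "leads (n + m) prepare s (\<lambda>s'. same {3, 4, 5, 6} {3, 4} s s' \<and>
    (\<exists>u. dir_ok n m v x u \<and> (\<forall>i<n. arr s' 3 (cnt s' 6) (m + i) = u i) \<and>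
      reach_inv n x u n (arr s' 4 0 2) \<and> reach_inv n x (\<lambda>i. - u i) n (arr s' 4 0 3)))"
    by (rule leads_prepare[OF s V x])
  then obtain s' u where s': "exec prepare s (poly (cost prepare) (n + m)) (return_pmf s')"
    "same {3, 4, 5, 6} {3, 4} s s'"
    and u: "dir_ok n m v x u" "\<And>i. i < n \<Longrightarrow> arr s' 3 (cnt s' 6) (m + i) = u i"
    and de: "reach_inv n x u n (arr s' 4 0 2)" "reach_inv n x (\<lambda>i. - u i) n (arr s' 4 0 3)"
    unfolding leads_def by blast
  define d e where "d = arr s' 4 0 2" and "e = arr s' 4 0 3"
  have move: "\<exists>s''. exec move (set_cnt 7 c s') (poly (cost move) (n + m)) (return_pmf s'') \<and>
      same {3, 4, 5, 6, 7} {2, 3, 4} s s'' \<and>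
      (\<forall>i. arr s'' 2 i 0 = x i + (if 0 < c then d else - e) * u i)" for c
  proof -
    have "leads (n + m) move (set_cnt 7 c s') (\<lambda>s''. same {3} {2, 4} (set_cnt 7 c s') s'' \<and>
        (\<forall>i. arr s'' 2 i 0 = x i + (if 0 < c then d else - e) * u i))"
      by (rule leads_move) (use s x(1) s'(2) u in \<open>auto simp: same_def d_def e_def dir_ok_def\<close>)
    then obtain s'' where "exec move (set_cnt 7 c s') (poly (cost move) (n + m)) (return_pmf s'')"
      and s'': "same {3} {2, 4} (set_cnt 7 c s') s''"
      and "\<forall>i. arr s'' 2 i 0 = x i + (if 0 < c then d else - e) * u i"
      unfolding leads_def by blast
    moreover have "same {3, 4, 5, 6, 7} {2, 3, 4} s s''" using s'(2) s'' by (simp add: same_def)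
    ultimately show ?thesis by blast
  qed
  obtain s1 where s1: "exec move (set_cnt 7 1 s') (poly (cost move) (n + m)) (return_pmf s1)"
    "same {3, 4, 5, 6, 7} {2, 3, 4} s s1" "\<And>i. arr s1 2 i 0 = x i + d * u i"
    using move[of 1] by auto
  obtain s2 where s2: "exec move (set_cnt 7 0 s') (poly (cost move) (n + m)) (return_pmf s2)"
    "same {3, 4, 5, 6, 7} {2, 3, 4} s s2" "\<And>i. arr s2 2 i 0 = x i - e * u i"
    using move[of 0] by auto
  define B where "B = bernoulli_pmf (e / (d + e))"
  define flip where "flip = Flip 7 (RDiv (scratch 3) (RPlus (scratch 2) (scratch 3)))"
  have "exec flip s' 1 (map_pmf (\<lambda>b. set_cnt 7 (if b then 1 else 0) s') B)"
    unfolding flip_def using exec_Flip[of 7 "RDiv (scratch 3) (RPlus (scratch 2) (scratch 3))" s']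
    by (simp add: B_def d_def e_def)
  \<comment> \<open>The continuation in \<open>exec_Seq\<close> depends on the store only, so the
    coin is read back from counter 7.\<close>
  then have "exec (Seq flip move) s' (1 + poly (cost move) (n + m) + 1)
      (bind_pmf (map_pmf (\<lambda>b. set_cnt 7 (if b then 1 else 0) s') B)
        (\<lambda>t. return_pmf (if cnt t 7 = 1 then s1 else s2)))"
    using s1(1) s2(1) by (intro exec_Seq) auto
  also have "bind_pmf (map_pmf (\<lambda>b. set_cnt 7 (if b then 1 else 0) s') B)
        (\<lambda>t. return_pmf (if cnt t 7 = 1 then s1 else s2)) = map_pmf (\<lambda>b. if b then s1 else s2) B"
    unfolding map_pmf_def bind_assoc_pmf bind_return_pmf by (intro bind_pmf_cong) auto
  finally have "exec walk_round s
      (poly (cost prepare) (n + m) + (1 + poly (cost move) (n + m) + 1) + 1)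
      (bind_pmf (return_pmf s') (\<lambda>_. map_pmf (\<lambda>b. if b then s1 else s2) B))"
    unfolding walk_round_def flip_def[symmetric] using s'(1) by (intro exec_Seq) auto
  then have "exec walk_round s (poly (cost walk_round) (n + m)) (map_pmf (\<lambda>b. if b then s1 else s2) B)"
    by (simp add: walk_round_def bind_return_pmf)
  then show ?thesis
    using that u(1) de s1(2,3) s2(2,3) by (simp add: B_def d_def e_def)
qed

text \<open>Nothing revives because \<open>w\<close> vanishes at frozen coordinates, and the
  coordinate supplied by \<open>reach_inv\<close> freezes. Both directions of the walk are covered
  by \<open>w\<close>.\<close>

lemma card_alive_move:
  assumes u: "dir_ok n m v x u" and w: "w = u \<or> w = (\<lambda>i. - u i)" and d: "reach_inv n x w n d"
    and c: "card (alive n x) \<le> Suc r"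
  shows "card (alive n (\<lambda>i. x i + d * w i)) \<le> r"
proof (cases "alive n x = {}")
  case True
  then have "w = (\<lambda>_. 0)" using u w by (auto simp: dir_ok_def)
  then show ?thesis using True by simp
next
  case False
  have "\<bar>x i\<bar> < 1" if "w i \<noteq> 0" for i using dir_ok_supp[OF u, of i] w that by auto
  then have sub: "alive n (\<lambda>i. x i + d * w i) \<subseteq> alive n x"
    by (force simp: alive_def)
  define p where "p = Max (alive n x)"
  have "p \<in> alive n x" using Max_in[OF finite_alive False] by (simp add: p_def)
  moreover have "u p = 1" using u False by (simp add: dir_ok_def walk_dir_def p_def)
  ultimately have p: "p < n" "\<bar>x p\<bar> < 1" "w p = 1 \<or> w p = - 1"
    using w by (auto simp: alive_def)
  \<comment> \<open>At the pivot \<open>w\<close> is 1 or -1, and a step of length 2 from inside the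
    interval would leave it.\<close>
  have "d \<noteq> 2"
  proof
    assume "d = 2"
    then have "\<bar>x p + 2 * w p\<bar> \<le> 1" using d p(1) by (simp add: reach_inv_def)
    then show False using p(2,3) by auto
  qed
  then obtain i where "i < n" "\<bar>x i\<bar> < 1" "\<bar>x i + d * w i\<bar> = 1"
    using d unfolding reach_inv_def by blast
  then have "i \<in> alive n x" "i \<notin> alive n (\<lambda>i. x i + d * w i)" by (simp_all add: alive_def)
  with sub have "alive n (\<lambda>i. x i + d * w i) \<subset> alive n x" by blast
  then have "card (alive n (\<lambda>i. x i + d * w i)) < card (alive n x)"
    by (intro psubset_card_mono finite_alive)
  then show ?thesis using c by simp
qed

section \<open>Expectation of the potential along the walk\<close>

lemma (in walk) dir_iff: "dir x u \<longleftrightarrow> walk_dir n m v (alive n x) (Max (alive n x)) u"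
  by (simp add: dir_def pivot_def)

text \<open>The supermartingale property, phrased with upper bounds: \<open>pot_le_move\<close>
  bounds both outcomes by values on the line, whose mean is the current potential.\<close>

lemma (in walk) pot_le_round:
  assumes u: "dir_ok n m v x u" and d: "reach_inv n x u n d" and e: "reach_inv n x (\<lambda>i. - u i) n e"
    and x: "\<And>i. i < n \<Longrightarrow> \<bar>x i\<bar> \<le> 1" and R: "pot_le x R"
  obtains R\<^sub>1 R\<^sub>2 where "pot_le (\<lambda>i. x i + d * u i) R\<^sub>1" "pot_le (\<lambda>i. x i - e * u i) R\<^sub>2"
    "e / (d + e) * R\<^sub>1 + (1 - e / (d + e)) * R\<^sub>2 \<le> R"
proof (cases "alive n x = {}")
  case True
  then have "u = (\<lambda>_. 0)" using u by (simp add: dir_ok_def)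
  then show ?thesis using that[of R R] R by (simp add: algebra_simps)
next
  case False
  then have dir: "dir x u" using u by (simp add: dir_iff dir_ok_def)
  have d': "0 < d" "\<And>i. i < n \<Longrightarrow> \<bar>x i + d * u i\<bar> \<le> 1"
    and e': "0 < e" "\<And>i. i < n \<Longrightarrow> \<bar>x i + (- e) * u i\<bar> \<le> 1"
    using d e by (simp_all add: reach_inv_def)
  have "pot_le (\<lambda>i. x i + d * u i) (pot_line x u (x (pivot x) + d))"
    by (rule pot_le_move[OF False dir x d'(2)])
  moreover have "pot_le (\<lambda>i. x i - e * u i) (pot_line x u (x (pivot x) - e))"
    using pot_le_move[OF False dir x e'(2)] by simp
  moreover have "pot x u \<le> R" using R False dir by (simp add: pot_le_def)
  then have "e / (d + e) * pot_line x u (x (pivot x) + d)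
      + (1 - e / (d + e)) * pot_line x u (x (pivot x) - e) \<le> R"
    unfolding pot_line_mean[OF d'(1) e'(1)] pot_line_pivot[OF False] .
  ultimately show ?thesis by (rule that)
qed

lemma expectation_bind_bernoulli:
  fixes f :: "'a \<Rightarrow> real"
  assumes "0 \<le> p" "p \<le> 1" "finite (set_pmf (N True))" "finite (set_pmf (N False))"
  shows "measure_pmf.expectation (bind_pmf (bernoulli_pmf p) N) f
    = p * measure_pmf.expectation (N True) f + (1 - p) * measure_pmf.expectation (N False) f"
proof -
  have "measure_pmf.expectation (bind_pmf (bernoulli_pmf p) N) f
      = (\<Sum>b\<in>UNIV. pmf (bernoulli_pmf p) b *\<^sub>R measure_pmf.expectation (N b) f)"
  proof (rule pmf_expectation_bind)
    show "finite (set_pmf (N b))" for b using assms by (cases b) auto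
  qed auto
  then show ?thesis using assms by (simp add: UNIV_bool)
qed

definition loop_body :: com where
  "loop_body = Seq walk_round (NSet 2 (NPlus (NVar 2) (NConst 1)))"

definition walk_state :: "nat \<Rightarrow> nat \<Rightarrow> (nat \<Rightarrow> nat \<Rightarrow> real) \<Rightarrow> store \<Rightarrow> bool" where
  "walk_state n m v s \<longleftrightarrow> cnt s 0 = n \<and> cnt s 1 = m \<and>
     (\<forall>i k. i < n \<longrightarrow> arr s 0 i k = (if k < m then v i k else 0)) \<and> (\<forall>i<n. \<bar>arr s 2 i 0\<bar> \<le> 1)"

text \<open>\<open>\<theta>\<close> is quantified inside, since one distribution \<open>M\<close>
  has to serve all test vectors.\<close>

definition walk_outcome ::
  "nat \<Rightarrow> nat \<Rightarrow> (nat \<Rightarrow> nat \<Rightarrow> real) \<Rightarrow> (nat \<Rightarrow> real) \<Rightarrow> store \<Rightarrow> store pmf \<Rightarrow> bool" where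
  "walk_outcome n m v x\<^sub>0 s M \<longleftrightarrow> finite (set_pmf M) \<and>
     (\<forall>s'\<in>set_pmf M. \<forall>i<n. \<bar>arr s' 2 i 0\<bar> = 1) \<and>
     (\<forall>\<theta> R. walk.pot_le n m v x\<^sub>0 \<theta> (\<lambda>i. arr s 2 i 0) R \<longrightarrow>
       measure_pmf.expectation M (\<lambda>s'. exp (walk.disc n m v x\<^sub>0 \<theta> (\<lambda>i. arr s' 2 i 0))) \<le> R)"

text \<open>Induction on the number \<open>r\<close> of remaining rounds, which bounds the number of
  alive coordinates. At \<open>r = 0\<close> all are frozen and the potential bound is the bound on
  \<open>exp (disc x)\<close>.\<close>

lemma exec_walk_loop:
  assumes norm: "\<And>i. i < n \<Longrightarrow> ip m (v i) (v i) \<le> 1"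
    and "walk_state n m v s" "r \<le> n" "cnt s 2 = n - r" "card (alive n (\<lambda>i. arr s 2 i 0)) \<le> r"
  shows "\<exists>M. exec (While (NLess (NVar 2) (NVar 0)) loop_body) s
      (r * (poly (cost loop_body) (n + m) + 2) + 1) M \<and> walk_outcome n m v x\<^sub>0 s M"
  using assms(2-)
proof (induction r arbitrary: s)
  case 0
  define x where "x = (\<lambda>i. arr s 2 i 0)"
  have fin: "alive n x = {}" using 0 finite_alive[of n x] by (simp add: x_def)
  have "\<bar>x i\<bar> = 1" if "i < n" for i
  proof -
    have "\<not> \<bar>x i\<bar> < 1" using fin that by (auto simp: alive_def)
    moreover have "\<bar>x i\<bar> \<le> 1" using 0 that by (simp add: walk_state_def x_def)
    ultimately show ?thesis by simp
  qed
  moreover have "exp (walk.disc n m v x\<^sub>0 \<theta> x) \<le> R" if "walk.pot_le n m v x\<^sub>0 \<theta> x R" for \<theta> R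
  proof -
    interpret walk n m v x\<^sub>0 \<theta> by unfold_locales (rule norm)
    show ?thesis using that fin by (simp add: pot_le_def)
  qed
  ultimately have "walk_outcome n m v x\<^sub>0 s (return_pmf s)" by (simp add: walk_outcome_def x_def)
  moreover have "exec (While (NLess (NVar 2) (NVar 0)) loop_body) s 1 (return_pmf s)"
    using 0 by (intro exec_While_False) (simp add: walk_state_def)
  ultimately show ?case by auto
next
  case (Suc r)
  define x where "x = (\<lambda>i. arr s 2 i 0)"
  have s: "cnt s 0 = n" "cnt s 1 = m" "\<And>i k. i < n \<Longrightarrow> arr s 0 i k = (if k < m then v i k else 0)"
    and x: "\<And>i. arr s 2 i 0 = x i" "\<And>i. i < n \<Longrightarrow> \<bar>x i\<bar> \<le> 1"
    using Suc.prems by (simp_all add: walk_state_def x_def)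
  obtain u d e s1 s2 where u: "dir_ok n m v x u" and d: "reach_inv n x u n d"
    and e: "reach_inv n x (\<lambda>i. - u i) n e"
    and s1: "same {3, 4, 5, 6, 7} {2, 3, 4} s s1" "\<And>i. arr s1 2 i 0 = x i + d * u i"
    and s2: "same {3, 4, 5, 6, 7} {2, 3, 4} s s2" "\<And>i. arr s2 2 i 0 = x i - e * u i"
    and ex: "exec walk_round s (poly (cost walk_round) (n + m))
      (map_pmf (\<lambda>b. if b then s1 else s2) (bernoulli_pmf (e / (d + e))))"
    using exec_walk_round[OF s x] by blast
  define p where "p = e / (d + e)"
  have de: "0 < d" "0 < e" using d e unfolding reach_inv_def by blast+
  then have p: "0 \<le> p" "p \<le> 1" by (simp_all add: p_def)
  define t where "t b = set_cnt 2 (n - r) (if b then s1 else s2)" for b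
  have "exec loop_body s (poly (cost walk_round) (n + m) + 1 + 1)
      (bind_pmf (map_pmf (\<lambda>b. if b then s1 else s2) (bernoulli_pmf p))
        (\<lambda>s'. return_pmf (set_cnt 2 (nval (NPlus (NVar 2) (NConst 1)) s') s')))"
    unfolding loop_body_def by (intro exec_Seq ex[folded p_def] exec_NSet)
  also have "bind_pmf (map_pmf (\<lambda>b. if b then s1 else s2) (bernoulli_pmf p))
        (\<lambda>s'. return_pmf (set_cnt 2 (nval (NPlus (NVar 2) (NConst 1)) s') s'))
      = map_pmf t (bernoulli_pmf p)"
  proof -
    have "cnt s1 2 = n - Suc r" "cnt s2 2 = n - Suc r" "Suc (n - Suc r) = n - r"
      using s1(1) s2(1) Suc.prems by (auto simp: same_def)
    then show ?thesis
      unfolding map_pmf_def bind_assoc_pmf bind_return_pmf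
      by (intro bind_pmf_cong) (auto simp: t_def)
  qed
  finally have body: "exec loop_body s (poly (cost loop_body) (n + m)) (map_pmf t (bernoulli_pmf p))"
    by (simp add: loop_body_def)
  have alive1: "card (alive n (\<lambda>i. x i + d * u i)) \<le> r"
    using card_alive_move[OF u _ d] Suc.prems by (simp add: x_def)
  have alive2: "card (alive n (\<lambda>i. x i - e * u i)) \<le> r"
    using card_alive_move[OF u _ e] Suc.prems by (simp add: x_def)
  have bounds: "\<bar>x i + d * u i\<bar> \<le> 1" "\<bar>x i - e * u i\<bar> \<le> 1" if "i < n" for i
    using d e that by (simp_all add: reach_inv_def)
  define W where "W = While (NLess (NVar 2) (NVar 0)) loop_body"
  define T where "T = r * (poly (cost loop_body) (n + m) + 2) + 1"
  \<comment> \<open>Chosen per store rather than per coin outcome, as \<open>exec_While_True\<close>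
    expects.\<close>
  define N where "N s' = (SOME M. exec W s' T M \<and> walk_outcome n m v x\<^sub>0 s' M)" for s'
  have N: "exec W (t b) T (N (t b)) \<and> walk_outcome n m v x\<^sub>0 (t b) (N (t b))" for b
    unfolding N_def
  proof (rule someI_ex, unfold W_def T_def, rule Suc.IH)
    show "walk_state n m v (t b)"
      using s s1 s2 bounds by (auto simp: walk_state_def t_def same_def)
    show "card (alive n (\<lambda>i. arr (t b) 2 i 0)) \<le> r"
      using alive1 alive2 by (simp add: t_def s1(2) s2(2))
  qed (use Suc.prems in \<open>auto simp: t_def\<close>)
  define M where "M = bind_pmf (bernoulli_pmf p) (\<lambda>b. N (t b))"
  have "exec W s (poly (cost loop_body) (n + m) + 2 + T) (bind_pmf (map_pmf t (bernoulli_pmf p)) N)"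
    unfolding W_def
  proof (rule exec_While_True[OF _ body])
    show "bval (NLess (NVar 2) (NVar 0)) s" using Suc.prems s by simp
  qed (use N in \<open>auto simp: W_def\<close>)
  then have "exec W s (Suc r * (poly (cost loop_body) (n + m) + 2) + 1) M"
    by (simp add: T_def M_def bind_map_pmf add_ac)
  moreover have "walk_outcome n m v x\<^sub>0 s M"
    unfolding walk_outcome_def
  proof (intro conjI allI impI ballI)
    show "finite (set_pmf M)" using N by (auto simp: M_def walk_outcome_def)
    show "\<bar>arr s' 2 i 0\<bar> = 1" if "s' \<in> set_pmf M" "i < n" for s' i
      using that N unfolding M_def walk_outcome_def by auto
    fix \<theta> R assume R: "walk.pot_le n m v x\<^sub>0 \<theta> (\<lambda>i. arr s 2 i 0) R"
    interpret walk n m v x\<^sub>0 \<theta> by unfold_locales (rule norm)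
    let ?E = "\<lambda>M. measure_pmf.expectation M (\<lambda>s'. exp (disc (\<lambda>i. arr s' 2 i 0)))"
    obtain R1 R2 where R12: "pot_le (\<lambda>i. x i + d * u i) R1" "pot_le (\<lambda>i. x i - e * u i) R2"
      "p * R1 + (1 - p) * R2 \<le> R"
      using pot_le_round[OF u d e x(2) R[folded x_def]] unfolding p_def by blast
    have "?E (N (t True)) \<le> R1" "?E (N (t False)) \<le> R2"
      using N[of True] N[of False] R12(1,2)
      by (auto simp: walk_outcome_def t_def s1(2) s2(2))
    then have "p * ?E (N (t True)) + (1 - p) * ?E (N (t False)) \<le> p * R1 + (1 - p) * R2"
      using p by (intro add_mono mult_left_mono) auto
    moreover have "?E M = p * ?E (N (t True)) + (1 - p) * ?E (N (t False))"
      unfolding M_def using N p by (intro expectation_bind_bernoulli) (auto simp: walk_outcome_def)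
    ultimately show "?E M \<le> R" using R12(3) by linarith
  qed
  ultimately show ?case unfolding W_def by blast
qed

section \<open>The whole program and its output\<close>

lemma exec_gram_schmidt_walk:
  assumes norm: "\<And>i. i < n \<Longrightarrow> ip m (v i) (v i) \<le> 1" and x: "\<And>i. i < n \<Longrightarrow> \<bar>x\<^sub>0 i\<bar> \<le> 1"
  obtains M where
    "exec gram_schmidt_walk (input n m v x\<^sub>0) (poly (cost gram_schmidt_walk) (n + m)) M"
    "finite (set_pmf M)" "\<And>s i. s \<in> set_pmf M \<Longrightarrow> i < n \<Longrightarrow> \<bar>arr s 2 i 0\<bar> = 1"
    "\<And>\<theta>. measure_pmf.expectation M
       (\<lambda>s. exp (ip m \<theta> (comb n v (\<lambda>i. arr s 2 i 0 - x\<^sub>0 i)))) \<le> exp (20 * ip m \<theta> \<theta>)"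
proof -
  \<comment> \<open>Array 2 is zero from row \<open>n\<close> on, so the walk starts at
    \<open>x\<^sub>0\<close> cut off there; \<open>comb\<close> sums over \<open>i < n\<close> only
    and does not notice.\<close>
  define y where "y = (\<lambda>i. if i < n then x\<^sub>0 i else 0)"
  define s where "s = input n m v x\<^sub>0"
  have "leads (n + m) copy_start s (\<lambda>s'. same {3} {2} s s' \<and> (\<forall>i. arr s' 2 i 0 = y i))"
    unfolding copy_start_def
    by (rule leads_mono[OF leads_fill_col[where N = n and f = x\<^sub>0]])
      (auto simp: s_def input_def same_def y_def)
  then obtain s1 where copy: "exec copy_start s (poly (cost copy_start) (n + m)) (return_pmf s1)"
    and s1: "same {3} {2} s s1" "\<And>i. arr s1 2 i 0 = y i"
    unfolding leads_def by blast
  define s2 where "s2 = set_cnt 2 0 s1"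
  have init: "exec (NSet 2 (NConst 0)) s1 1 (return_pmf s2)"
    using exec_NSet[of 2 "NConst 0" s1] by (simp add: s2_def)
  have "walk_state n m v s2"
    using s1 x by (auto simp: walk_state_def s2_def same_def s_def input_def y_def)
  moreover have "card (alive n (\<lambda>i. arr s2 2 i 0)) \<le> n"
    using card_mono[of "{..<n}" "alive n (\<lambda>i. arr s2 2 i 0)"] by (auto simp: alive_def)
  ultimately obtain M where
    M: "exec (While (NLess (NVar 2) (NVar 0)) loop_body) s2
      (n * (poly (cost loop_body) (n + m) + 2) + 1) M" "walk_outcome n m v y s2 M"
    using exec_walk_loop[of n m v s2 n y] norm by (auto simp: s2_def)
  have le: "n * (poly (cost loop_body) (n + m) + 2) + 1
      \<le> poly (cost (While (NLess (NVar 2) (NVar 0)) loop_body)) (n + m)"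
    by (simp add: distrib_right)
  have "exec (For 2 (NVar 0) walk_round) s1
      (1 + poly (cost (While (NLess (NVar 2) (NVar 0)) loop_body)) (n + m) + 1)
      (bind_pmf (return_pmf s2) (\<lambda>_. M))"
    unfolding For_def loop_body_def[symmetric]
    by (rule exec_Seq[OF init]) (use exec_mono[OF M(1) le] in auto)
  then have "exec (For 2 (NVar 0) walk_round) s1 (poly (cost (For 2 (NVar 0) walk_round)) (n + m)) M"
    by (simp add: For_def loop_body_def bind_return_pmf add_ac)
  then have "exec gram_schmidt_walk s (poly (cost copy_start) (n + m)
      + poly (cost (For 2 (NVar 0) walk_round)) (n + m) + 1) (bind_pmf (return_pmf s1) (\<lambda>_. M))"
    unfolding gram_schmidt_walk_def by (intro exec_Seq[OF copy]) auto
  then have "exec gram_schmidt_walk s (poly (cost gram_schmidt_walk) (n + m)) M"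
    by (simp add: gram_schmidt_walk_def bind_return_pmf)
  moreover have "measure_pmf.expectation M
       (\<lambda>s. exp (ip m \<theta> (comb n v (\<lambda>i. arr s 2 i 0 - x\<^sub>0 i)))) \<le> exp (20 * ip m \<theta> \<theta>)" for \<theta>
  proof -
    interpret walk n m v y \<theta> by unfold_locales (rule norm)
    have "comb n v (\<lambda>i. z i - x\<^sub>0 i) = comb n v (\<lambda>i. z i - y i)" for z
      by (simp add: comb_def y_def)
    then have eq: "disc z = ip m \<theta> (comb n v (\<lambda>i. z i - x\<^sub>0 i))" for z
      by (simp add: disc_def)
    have "pot_le (\<lambda>i. arr s2 2 i 0) (exp (20 * ip m \<theta> \<theta>))"
      using pot_le_initial by (simp add: s2_def s1(2))
    then have "measure_pmf.expectation M (\<lambda>s. exp (disc (\<lambda>i. arr s 2 i 0))) \<le> exp (20 * ip m \<theta> \<theta>)"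
      using M(2) unfolding walk_outcome_def by blast
    then show ?thesis by (simp add: eq)
  qed
  ultimately show ?thesis
    using that[of M] M(2) unfolding walk_outcome_def s_def by blast
qed

theorem theorem3:
  shows "\<exists>(P::com) (p::nat poly).
    \<forall>(n::nat) (m::nat) (v::nat \<Rightarrow> nat \<Rightarrow> real) (x\<^sub>0::nat \<Rightarrow> real).
      (\<forall>i<n. L2_set (v i) {..<m} \<le> 1) \<longrightarrow>
      (\<forall>i<n. x\<^sub>0 i \<in> {-1..1}) \<longrightarrow>
      halts_within (poly p (n + m)) P (input n m v x\<^sub>0) \<and>
      (\<forall>x \<in> set_pmf (output_after (poly p (n + m)) P (input n m v x\<^sub>0)).
         \<forall>i<n. x i \<in> {-1, 1}) \<and>
      subgaussian m
        (measure_pmf (output_after (poly p (n + m)) P (input n m v x\<^sub>0)))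
        (\<lambda>x j. \<Sum>i<n. (x i - x\<^sub>0 i) * v i j)
        (sqrt 40)"
proof (intro exI[of _ gram_schmidt_walk] exI[of _ "cost gram_schmidt_walk"] allI impI)
  fix n m :: nat and v :: "nat \<Rightarrow> nat \<Rightarrow> real" and x\<^sub>0 :: "nat \<Rightarrow> real"
  assume v: "\<forall>i<n. L2_set (v i) {..<m} \<le> 1" and x\<^sub>0: "\<forall>i<n. x\<^sub>0 i \<in> {-1..1}"
  let ?T = "poly (cost gram_schmidt_walk) (n + m)" and ?s = "input n m v x\<^sub>0"
  have norm: "ip m (v i) (v i) \<le> 1" if "i < n" for i
    using v that by (simp add: ip_L2_set power_le_one)
  have start: "\<bar>x\<^sub>0 i\<bar> \<le> 1" if "i < n" for i
    using x\<^sub>0 that by (auto simp: abs_le_iff)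
  obtain M where M: "exec gram_schmidt_walk ?s ?T M" "finite (set_pmf M)"
    "\<And>s i. s \<in> set_pmf M \<Longrightarrow> i < n \<Longrightarrow> \<bar>arr s 2 i 0\<bar> = 1"
    "\<And>\<theta>. measure_pmf.expectation M
       (\<lambda>s. exp (ip m \<theta> (comb n v (\<lambda>i. arr s 2 i 0 - x\<^sub>0 i)))) \<le> exp (20 * ip m \<theta> \<theta>)"
    using exec_gram_schmidt_walk[of n m v x\<^sub>0, OF norm start] by blast
  have run: "run ?T (gram_schmidt_walk, ?s) = map_pmf (Pair Skip) M"
    using M(1) by (simp add: exec_def)
  have out: "output_after ?T gram_schmidt_walk ?s = map_pmf (\<lambda>s i. arr s 2 i 0) M"
    by (simp add: output_after_def run map_pmf_comp)
  have "halts_within ?T gram_schmidt_walk ?s"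
    by (auto simp: halts_within_def run)
  moreover have "x i \<in> {-1, 1}"
    if x: "x \<in> set_pmf (output_after ?T gram_schmidt_walk ?s)" and i: "i < n" for x i
  proof -
    have "\<bar>x i\<bar> = 1" using x M(3) i by (auto simp: out)
    then show ?thesis by auto
  qed
  moreover have "subgaussian m (measure_pmf (output_after ?T gram_schmidt_walk ?s))
      (\<lambda>x j. \<Sum>i<n. (x i - x\<^sub>0 i) * v i j) (sqrt 40)"
    unfolding subgaussian_def
  proof (intro conjI allI impI)
    show "prob_space (measure_pmf (output_after ?T gram_schmidt_walk ?s))"
      by (rule measure_pmf.prob_space_axioms)
  next
    fix \<theta> :: "nat \<Rightarrow> real"
    show "integrable (measure_pmf (output_after ?T gram_schmidt_walk ?s))
        (\<lambda>x. exp (\<Sum>j<m. \<theta> j * (\<Sum>i<n. (x i - x\<^sub>0 i) * v i j)))"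
      by (rule integrable_measure_pmf_finite) (simp add: out M(2))
    show "(\<integral>x. exp (\<Sum>j<m. \<theta> j * (\<Sum>i<n. (x i - x\<^sub>0 i) * v i j))
        \<partial>measure_pmf (output_after ?T gram_schmidt_walk ?s))
        \<le> exp ((sqrt 40)\<^sup>2 / 2 * (L2_set \<theta> {..<m})\<^sup>2)"
      \<comment> \<open>Half of \<open>(sqrt 40)\<^sup>2\<close> is 20, the constant in the
        potential.\<close>
      using M(4)[of \<theta>] by (simp add: out comb_def ip_L2_set) (simp add: ip_def)
  qed simp
  ultimately show "halts_within ?T gram_schmidt_walk ?s \<and>
      (\<forall>x \<in> set_pmf (output_after ?T gram_schmidt_walk ?s). \<forall>i<n. x i \<in> {-1, 1}) \<and>
      subgaussian m (measure_pmf (output_after ?T gram_schmidt_walk ?s))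
        (\<lambda>x j. \<Sum>i<n. (x i - x\<^sub>0 i) * v i j) (sqrt 40)"
    by blast
qed

end
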